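(* Let $n$ be a positive integer. For all complex $z$ with $0<|z|\le 1$, \[ \sum_{k=1}^\infty \frac{(-1)^k\zeta(2k)z^{2k}}{k(2k+n)} = -\frac{1}{n^2}-\frac{\pi z}{n+1}+\frac{\ln(2\pi z)}{n}+\frac{(n-1)!}{(2\pi z)^n}\zeta(n+1)-(n-1)!\sum_{j=1}^{n}\frac{\operatorname{Li}_{j+1}(e^{-2\pi z})}{(n-j)!\,(2\pi z)^j}. \]
   Context: $\zeta(s)=\sum_{k\ge1}k^{-s}$ is the Riemann zeta function. $\operatorname{Li}_s(x)=\sum_{k\ge1}x^k/k^s$ is the polylogarithm of order $s$. $\ln$ denotes the natural logarithm (principal branch for complex arguments).
   Formalization: For Re z < 0 the series for Li_{j+1}(e^{-2πz}) diverges; there Li denotes its principal-branch analytic continuation (Li_1(x) = -ln(1-x), Li_{s+1}(x) = ∫_0^x Li_s(t)/t dt along the segment), with ln of a negative real having imaginary part π. *)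

theory Defs
  imports "HOL-Complex_Analysis.Complex_Analysis"
begin

text \<open>Riemann zeta function at integer arguments (only used at arguments \<ge> 2,
  where the defining series converges): zeta(s) = sum over k \<ge> 1 of k^(-s).\<close>
definition riemann_zeta :: "nat \<Rightarrow> real" where
  "riemann_zeta s = (\<Sum>k. 1 / (real (Suc k)) ^ s)"

text \<open>Principal-branch analytic continuation of the polylogarithm of integer order
  to the whole plane: Li_0(x) = x/(1-x), Li_1(x) = -Ln(1-x),
  Li_(s+1)(x) = integral from 0 to x (straight segment) of Li_s(t)/t.\<close>
fun polylog_cont :: "nat \<Rightarrow> complex \<Rightarrow> complex" where
  "polylog_cont 0 x = x / (1 - x)"
| "polylog_cont (Suc 0) x = - Ln (1 - x)"
| "polylog_cont (Suc (Suc s)) x =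
     contour_integral (linepath 0 x) (\<lambda>t. polylog_cont (Suc s) t / t)"

definition polylog :: "nat \<Rightarrow> complex \<Rightarrow> complex" where
  "polylog s x = (if norm x \<le> 1 then (\<Sum>k. x ^ Suc k / of_nat (Suc k) ^ s)
                  else polylog_cont s x)"

end

theory Submission
  imports Defs
begin

text \<open>
  Put \<open>G(z) = \<Sum>k\<ge>1. (-1)^k \<zeta>(2k) z^(2k) / k\<close>. Expanding \<open>\<zeta>(2k)\<close> and exchanging the sums, the
  product formula for the sine gives \<open>exp (-G(z)) = sinh (\<pi>z) / (\<pi>z)\<close>, hence
  \<open>G(z) = -\<pi>z + Ln (2\<pi>z) + Li_1(e^(-2\<pi>z))\<close>. Both \<open>z^n\<close> times the series and \<open>z^n\<close> times the
  right-hand side have derivative \<open>z^(n-1) G(z)\<close>, because \<open>Li_(s+1)(e^(-2\<pi>z))\<close> has derivative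
  \<open>-2\<pi> Li_s(e^(-2\<pi>z))\<close> and the sum over \<open>j\<close> telescopes; both tend to \<open>0\<close> at \<open>0\<close>.

  This argument runs on the unit disc slit along the negative reals, where \<open>e^(-2\<pi>z)\<close> avoids the
  cut \<open>[1,\<infinity>)\<close>. On \<open>(-1,0)\<close> it is repeated in one real variable: there \<open>Ln (2\<pi>z)\<close> and
  \<open>Ln (1 - e^(-2\<pi>z))\<close> both sit on the upper side of their cuts, so the jumps \<open>i\<pi>\<close> cancel, and
  \<open>Li_(s+1)\<close> is an indefinite integral across the integrable singularity at \<open>1\<close>. The unit circle is
  reached by radial limits.
\<close>

subsection \<open>Polylogarithms on the slit plane\<close>

text \<open>Since \<open>f 0 = 0\<close>, the quotient \<open>f t / t\<close> has a removable
  singularity at the origin. The repaired quotient is holomorphic on a set that is star-shaped about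
  \<open>0\<close>, hence has a primitive, and the radial integral is a difference of its
  values.\<close>

lemma has_field_derivative_radial_integral:
  fixes f :: "complex \<Rightarrow> complex"
  assumes S: "open S" "\<And>y. y \<in> S \<Longrightarrow> closed_segment 0 y \<subseteq> S"
    and f: "f holomorphic_on S" "f 0 = 0" and x: "x \<in> S"
  shows "((\<lambda>x. contour_integral (linepath 0 x) (\<lambda>t. f t / t)) has_field_derivative
           (if x = 0 then deriv f 0 else f x / x)) (at x)"
proof -
  define h where "h = (\<lambda>t. if t = 0 then deriv f 0 else f t / t)"
  have h: "h holomorphic_on S"
    by (rule pole_theorem_open_0[of f S 0]) (use S f in \<open>auto simp: h_def\<close>)
  have "0 \<in> S" using S(2)[OF x] by auto
  then have "starlike S" unfolding starlike_def using S(2) by blast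
  then obtain G where G: "\<And>y. y \<in> S \<Longrightarrow> (G has_field_derivative h y) (at y)"
    using holomorphic_starlike_primitive[of S h "{}"] h S
    by (auto simp: holomorphic_on_imp_continuous_on holomorphic_on_imp_differentiable_at)
  have eq: "contour_integral (linepath 0 y) (\<lambda>t. f t / t) = G y - G 0" if y: "y \<in> S" for y
  proof -
    have "(h has_contour_integral (G (pathfinish (linepath 0 y)) - G (pathstart (linepath 0 y)))) (linepath 0 y)"
      by (rule contour_integral_primitive[of S])
        (use G y S in \<open>auto intro: has_field_derivative_at_within simp del: linepath_0\<close>)
    then have "((\<lambda>u. h (linepath 0 y u) * (y - 0)) has_integral (G y - G 0)) {0..1}"
      by (simp add: has_contour_integral_linepath)
    \<comment> \<open>The two integrands can differ only at \<open>u = 0\<close>, where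
      \<open>f t / t\<close> is \<open>0\<close> by the convention for division while
      \<open>h\<close> takes the value \<open>deriv f 0\<close>.\<close>
    then have "((\<lambda>u. f (linepath 0 y u) / linepath 0 y u * (y - 0)) has_integral (G y - G 0)) {0..1}"
      by (rule has_integral_spike_finite[where S = "{0}", rotated 2])
        (auto simp: h_def linepath_def)
    then show ?thesis
      by (intro contour_integral_unique) (simp add: has_contour_integral_linepath)
  qed
  have "((\<lambda>y. G y - G 0) has_field_derivative h x) (at x)"
    by (auto intro!: derivative_eq_intros G x)
  then have "((\<lambda>x. contour_integral (linepath 0 x) (\<lambda>t. f t / t)) has_field_derivative h x) (at x)"
    by (rule has_field_derivative_transform_within_open[OF _ S(1) x]) (simp add: eq)
  then show ?thesis by (simp add: h_def)
qed

definition slit_plane :: "complex set" where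
  "slit_plane = - (complex_of_real ` {1..})"

lemma in_slit_plane_iff: "x \<in> slit_plane \<longleftrightarrow> Im x \<noteq> 0 \<or> Re x < 1"
proof -
  have "x \<in> complex_of_real ` {1..} \<longleftrightarrow> Im x = 0 \<and> Re x \<ge> 1"
    by (auto simp: complex_eq_iff image_iff)
  then show ?thesis by (auto simp: slit_plane_def)
qed

lemma open_slit_plane: "open slit_plane"
  unfolding slit_plane_def by (intro open_Compl closed_slot_right)

lemma closed_segment_slit_plane:
  assumes "x \<in> slit_plane"
  shows "closed_segment 0 x \<subseteq> slit_plane"
proof
  fix y assume "y \<in> closed_segment 0 x"
  then obtain u where u: "0 \<le> u" "u \<le> 1" "y = of_real u * x"
    by (auto simp: in_segment scaleR_conv_of_real)
  show "y \<in> slit_plane"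
  proof (cases "Im x = 0")
    case True
    then have "Re x < 1" using assms by (simp add: in_slit_plane_iff)
    then have "u * Re x < 1" using u
      by (smt (verit) mult_left_le_one_le mult_nonneg_nonpos)
    then show ?thesis using u by (simp add: in_slit_plane_iff)
  next
    case False
    then show ?thesis using u by (cases "u = 0") (auto simp: in_slit_plane_iff)
  qed
qed

lemma polylog_cont_0_right: "polylog_cont s 0 = 0"
  by (induction s "0::complex" rule: polylog_cont.induct) auto

text \<open>Order one is \<open>Ln\<close> off its cut. Each further order is a radial integral over
  the slit plane, which is star-shaped about \<open>0\<close>.\<close>

lemma holomorphic_polylog_cont:
  assumes "s \<ge> 1"
  shows "polylog_cont s holomorphic_on slit_plane"
  using assms
proof (induction s rule: dec_induct)
  case base
  have "1 - x \<notin> \<real>\<^sub>\<le>\<^sub>0" if "x \<in> slit_plane" for x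
    using that by (auto simp: in_slit_plane_iff complex_nonpos_Reals_iff)
  then show ?case unfolding One_nat_def polylog_cont.simps
    by (auto intro!: holomorphic_intros)
next
  case (step s)
  then obtain t where s: "s = Suc t" by (cases s) auto
  show ?case
    unfolding holomorphic_on_open[OF open_slit_plane] s polylog_cont.simps
    using has_field_derivative_radial_integral[OF open_slit_plane closed_segment_slit_plane step.IH
        polylog_cont_0_right] s by blast
qed

lemma has_field_derivative_polylog_cont:
  assumes "s \<ge> 1" "x \<in> slit_plane" "x \<noteq> 0"
  shows "(polylog_cont (Suc s) has_field_derivative polylog_cont s x / x) (at x)"
proof -
  obtain t where s: "s = Suc t" using assms by (cases s) auto
  show ?thesis
    using has_field_derivative_radial_integral[OF open_slit_plane closed_segment_slit_plane
        holomorphic_polylog_cont[OF assms(1)] polylog_cont_0_right assms(2)] assms(3)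
    unfolding s polylog_cont.simps by simp
qed

text \<open>For \<open>s \<ge> 1\<close> the term at \<open>k = 0\<close> is \<open>1 / 0 = 0\<close>.\<close>

definition polylog_series :: "nat \<Rightarrow> complex \<Rightarrow> complex" where
  "polylog_series s x = (\<Sum>k. (1 / of_nat k ^ s) * x ^ k)"

lemma summable_polylog_series:
  assumes "norm (x :: complex) < 1"
  shows "summable (\<lambda>k. (1 / of_nat k ^ s) * x ^ k)"
proof (rule summable_comparison_test')
  show "summable (\<lambda>k. norm x ^ k)" using assms by (intro summable_geometric) auto
  show "norm ((1 / of_nat k ^ s) * x ^ k) \<le> norm x ^ k" if "k \<ge> 1" for k
  proof -
    have "1 / real k ^ s \<le> 1" using that by (simp add: divide_simps)
    then show ?thesis
      by (simp add: norm_mult norm_divide norm_power mult_left_le_one_le flip: times_divide_eq_left)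
  qed
qed

text \<open>The majorant is independent of \<open>x\<close>, so from order two on the M-test reaches
  the closed disc, unit circle included.\<close>

lemma norm_polylog_series_term_le:
  assumes "s \<ge> 2" "norm (x :: complex) \<le> 1"
  shows "norm ((1 / of_nat k ^ s) * x ^ k) \<le> 1 / real k ^ 2"
proof (cases "k = 0")
  case False
  have "real k ^ 2 \<le> real k ^ s" using False assms by (intro power_increasing) auto
  then have "1 / real k ^ s \<le> 1 / real k ^ 2" using False by (simp add: frac_le)
  moreover have "norm x ^ k \<le> 1" using assms by (simp add: power_le_one)
  ultimately have "(1 / real k ^ s) * norm x ^ k \<le> (1 / real k ^ 2) * 1"
    by (intro mult_mono) auto
  then show ?thesis by (simp add: norm_mult norm_divide norm_power)
qed (use assms in auto)

lemma summable_inverse_power2: "summable (\<lambda>k. 1 / real k ^ 2)"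
  using inverse_power_summable[of 2, where 'a = real] by (simp add: field_simps)

lemma polylog_eq_series:
  assumes "s \<ge> 1" "norm x < 1 \<or> (s \<ge> 2 \<and> norm x \<le> 1)"
  shows "polylog s x = polylog_series s x"
proof -
  have "summable (\<lambda>k. (1 / of_nat k ^ s) * x ^ k)"
    using assms(2)
  proof
    assume "s \<ge> 2 \<and> norm x \<le> 1"
    then show ?thesis
      by (intro summable_comparison_test'[OF summable_inverse_power2, of 0])
        (use norm_polylog_series_term_le[of s x] in auto)
  qed (rule summable_polylog_series)
  from suminf_split_head[OF this] show ?thesis
    using assms by (auto simp: polylog_def polylog_series_def)
qed

lemma continuous_on_polylog_series:
  assumes "s \<ge> 2"
  shows "continuous_on (cball 0 1) (polylog_series s)"
  unfolding polylog_series_def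
proof (rule uniform_limit_theorem)
  show "uniform_limit (cball 0 1) (\<lambda>n x. \<Sum>k<n. (1 / of_nat k ^ s) * x ^ k)
          (\<lambda>x::complex. \<Sum>k. (1 / of_nat k ^ s) * x ^ k) sequentially"
    by (rule Weierstrass_m_test[OF _ summable_inverse_power2])
      (use assms norm_polylog_series_term_le in auto)
qed (auto intro!: always_eventually continuous_on_sum continuous_on_mult[OF continuous_on_const]
    continuous_on_power continuous_on_id simp del: times_divide_eq_left)

lemma has_field_derivative_polylog_series:
  assumes "s \<ge> 1" "norm x < 1" "x \<noteq> 0"
  shows "(polylog_series (Suc s) has_field_derivative polylog_series s x / x) (at x)"
proof -
  let ?c = "\<lambda>k. 1 / of_nat k ^ Suc s :: complex"
  have "((\<lambda>x. \<Sum>k. ?c k * x ^ k) has_field_derivative (\<Sum>k. diffs ?c k * x ^ k)) (at x)"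
    by (rule termdiffs_strong'[of 1]) (use assms(2) summable_polylog_series[where s = "Suc s"] in auto)
  moreover have "(\<Sum>k. diffs ?c k * x ^ k) = polylog_series s x / x"
  proof -
    have "(\<lambda>k. (1 / of_nat (Suc k) ^ s) * x ^ Suc k) sums polylog_series s x"
      unfolding polylog_series_def
      using summable_sums[OF summable_polylog_series[OF assms(2), of s]] assms(1)
      by (subst sums_Suc_iff) (auto simp: power_0_left)
    moreover have "diffs ?c k = 1 / of_nat (Suc k) ^ s" for k
      by (simp add: diffs_def del: of_nat_Suc)
    ultimately show ?thesis
      using assms(3) sums_divide[of _ "polylog_series s x" x]
      by (intro sums_unique[symmetric]) (fastforce simp del: of_nat_Suc)
  qed
  ultimately show ?thesis unfolding polylog_series_def by simp
qed

text \<open>Order one is the logarithm series. In the step, both functions of order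
  \<open>Suc s\<close> have derivative \<open>Li_s(x) / x\<close> away from \<open>0\<close>, so
  they differ by a constant, which is \<open>0\<close> by evaluation at the origin.\<close>

lemma polylog_cont_eq_series:
  assumes "s \<ge> 1" "norm x < 1"
  shows "polylog_cont s x = polylog_series s x"
  using assms(1,2)
proof (induction s arbitrary: x rule: dec_induct)
  case base
  have "(\<lambda>k. - (- ((- (-x)) ^ k) / of_nat k)) sums (- ln (1 + (-x)))"
    by (intro sums_minus Ln_series') (use base in auto)
  then show ?case by (simp add: polylog_series_def sums_iff)
next
  case (step s)
  have sub: "ball 0 1 \<subseteq> slit_plane"
  proof
    fix y :: complex assume "y \<in> ball 0 1"
    then show "y \<in> slit_plane"
      using complex_Re_le_cmod[of y] by (auto simp: in_slit_plane_iff)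
  qed
  \<comment> \<open>Continuity takes care of the origin, where the derivative formula divides by
    zero; the disc minus \<open>{0}\<close> is handled by derivatives.\<close>
  have "continuous_on (ball 0 1) (\<lambda>x. polylog_cont (Suc s) x - polylog_series (Suc s) x)"
    using holomorphic_on_imp_continuous_on[OF holomorphic_polylog_cont[of "Suc s"]]
      continuous_on_polylog_series[of "Suc s"] step sub
    by (intro continuous_intros)
      (auto elim!: continuous_on_subset)
  then obtain c where c: "\<And>x. x \<in> ball 0 1 \<Longrightarrow> polylog_cont (Suc s) x - polylog_series (Suc s) x = c"
  proof (rule DERIV_zero_connected_constant[rotated 3, of _ _ "{0}"])
    show "\<forall>x\<in>ball 0 1 - {0}. ((\<lambda>x. polylog_cont (Suc s) x - polylog_series (Suc s) x)
        has_field_derivative 0) (at x)"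
    proof
      fix x :: complex assume x: "x \<in> ball 0 1 - {0}"
      then show "((\<lambda>x. polylog_cont (Suc s) x - polylog_series (Suc s) x)
        has_field_derivative 0) (at x)"
        using has_field_derivative_polylog_cont[of s x] has_field_derivative_polylog_series[of s x]
          step sub by (auto intro!: derivative_eq_intros)
    qed
  qed auto
  have "c = 0" using c[of 0] polylog_cont_0_right[of "Suc s"]
    by (simp add: polylog_series_def power_0_left if_distrib[of "\<lambda>x. x / _"] cong: if_cong)
  then show ?case using c[of x] step by auto
qed

text \<open>Outside the closed disc this is the definition. Inside it, series and continuation agree
  at \<open>r * x\<close> for \<open>0 < r < 1\<close>, and both are continuous as \<open>r\<close>
  tends to \<open>1\<close> from below.\<close>

lemma polylog_eq_polylog_cont:
  assumes "s \<ge> 2" "x \<in> slit_plane"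
  shows "polylog s x = polylog_cont s x"
proof (cases "norm x \<le> 1")
  case True
  have "polylog_series s x = polylog_cont s x"
  proof (rule tendsto_unique)
    let ?F = "at_left (1::real)"
    have ev: "\<forall>\<^sub>F r in ?F. r \<in> {0<..<1}"
      by (rule eventually_at_leftI[of 0]) auto
    have lim: "((\<lambda>r. of_real r * x) \<longlongrightarrow> x) ?F"
      by (auto intro!: tendsto_eq_intros)
    have bd: "norm (of_real r * x) < 1" if "r \<in> {0<..<1}" for r
      using that True by (simp add: norm_mult) (smt (verit) mult_left_le norm_ge_zero)
    show "((\<lambda>r. polylog_series s (of_real r * x)) \<longlongrightarrow> polylog_series s x) ?F"
      by (rule continuous_on_tendsto_compose[OF continuous_on_polylog_series lim])
        (use assms True ev bd in \<open>auto elim!: eventually_mono intro: less_imp_le\<close>)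
    have "((\<lambda>r. polylog_cont s (of_real r * x)) \<longlongrightarrow> polylog_cont s x) ?F"
      by (rule isCont_tendsto_compose[OF _ lim])
        (use assms holomorphic_on_imp_continuous_on[OF holomorphic_polylog_cont[of s]] in
          \<open>auto simp: continuous_on_eq_continuous_at open_slit_plane\<close>)
    then show "((\<lambda>r. polylog_series s (of_real r * x)) \<longlongrightarrow> polylog_cont s x) ?F"
      by (rule Lim_transform_eventually)
        (use ev in eventually_elim, use polylog_cont_eq_series bd assms in auto)
  qed auto
  then show ?thesis using polylog_eq_series[of s x] assms True by auto
qed (auto simp: polylog_def)

subsection \<open>Polylogarithms along the branch cut\<close>

text \<open>This function serves twice: in the primitive of the logarithm across the singularity
  \<open>t = 1\<close>, and in the vanishing of \<open>z^n Ln z\<close> at the origin.\<close>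

lemma continuous_on_times_ln_abs: "continuous_on UNIV (\<lambda>u::real. u * ln \<bar>u\<bar>)"
proof -
  have "isCont (\<lambda>u::real. u * ln \<bar>u\<bar>) u" for u
  proof (cases "u = 0")
    case True
    have 1: "((\<lambda>u::real. u * ln u) \<longlongrightarrow> 0) (at_right 0)"
      by real_asymp
    have "((\<lambda>u::real. u * ln \<bar>u\<bar>) \<longlongrightarrow> 0) (at_right 0)"
      by (rule Lim_transform_eventually[OF 1])
        (auto simp: eventually_at_right_field intro!: exI[of _ 1])
    moreover have "((\<lambda>u::real. u * ln \<bar>u\<bar>) \<longlongrightarrow> 0) (at_left 0)"
      unfolding filterlim_at_left_to_right using tendsto_minus[OF calculation] by simp
    ultimately show ?thesis using True by (simp add: isCont_def filterlim_at_split)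
  qed (auto intro!: continuous_intros)
  then show ?thesis by (simp add: continuous_on_eq_continuous_at)
qed

lemma Ln_of_real_cases:
  assumes "u \<noteq> 0"
  shows "Ln (of_real u) = of_real (ln \<bar>u\<bar>) + \<i> * of_real (if u < 0 then pi else 0)"
  using Ln_of_real[of u] Ln_of_real'[of u] assms by auto

text \<open>Integration by parts against the continuous primitive \<open>(1 - t) Ln (1 - t) + t\<close> of \<open>- Ln (1 - t)\<close>
  crosses the singularity at \<open>t = 1\<close>.\<close>

lemma integrable_Ln_one_minus_over:
  assumes "1/2 \<le> b"
  shows "(\<lambda>t. - Ln (1 - complex_of_real t) / of_real t) integrable_on {1/2..b}"
proof -
  \<comment> \<open>The real part is a primitive of \<open>- ln \<bar>1 - t\<bar>\<close>. The
    imaginary part, with its kink at \<open>1\<close>, is a primitive of \<open>0\<close> before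
    \<open>1\<close> and of \<open>- pi\<close> after it, matching the value of \<open>Ln\<close> on
    its cut.\<close>
  let ?A = "\<lambda>t. of_real ((1 - t) * ln \<bar>1 - t\<bar> + t) + \<i> * of_real (pi * min 0 (1 - t)) :: complex"
  have "(\<lambda>t. - Ln (1 - complex_of_real t) * (1 / of_real t)) integrable_on {1/2..b}"
  proof (rule integrable_by_parts_interior_strong[OF bounded_bilinear_mult, of "{1}" _ _ ?A _ _ "\<lambda>t. - 1 / of_real t ^ 2"])
    have "continuous_on UNIV (\<lambda>t::real. (1 - t) * ln \<bar>1 - t\<bar>)"
      by (rule continuous_on_compose2[OF continuous_on_times_ln_abs, of _ "\<lambda>t. 1 - t"])
        (auto intro!: continuous_intros)
    then have "continuous_on UNIV (\<lambda>t::real. (1 - t) * ln \<bar>1 - t\<bar> + t)"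
      by (intro continuous_on_add continuous_on_id)
    then have A: "continuous_on UNIV ?A"
      by (intro continuous_on_add[OF continuous_on_of_real continuous_on_mult] continuous_on_of_real
          continuous_on_mult[OF continuous_on_const] continuous_on_const
          continuous_on_min continuous_on_diff continuous_on_id)
    then show "continuous_on {1/2..b} ?A" by (rule continuous_on_subset) auto
    show "continuous_on {1/2..b} (\<lambda>t. 1 / complex_of_real t)"
      by (intro continuous_intros) auto
    show "((\<lambda>t. 1 / complex_of_real t) has_vector_derivative - 1 / (complex_of_real t)\<^sup>2) (at t)"
      if "t \<in> {1/2<..<b} - {1}" for t
      by (rule has_vector_derivative_real_field)
        (use that in \<open>auto intro!: derivative_eq_intros simp: power2_eq_square field_simps\<close>)
    show "(?A has_vector_derivative - Ln (1 - complex_of_real t)) (at t)"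
      if t: "t \<in> {1/2<..<b} - {1}" for t
    proof -
      let ?c = "if 1 - t < 0 then pi else 0"
      have 1: "((\<lambda>t. (1 - t) * ln \<bar>1 - t\<bar> + t) has_real_derivative - ln \<bar>1 - t\<bar>) (at t)"
      proof (cases "t < 1")
        case True
        have "((\<lambda>t. (1 - t) * ln (1 - t) + t) has_real_derivative - ln \<bar>1 - t\<bar>) (at t)"
          using True by (auto intro!: derivative_eq_intros simp: divide_simps)
        then show ?thesis
          by (rule has_field_derivative_transform_within_open[of _ _ _ "{..<1}"]) (use True in auto)
      next
        case False
        then have "t > 1" using t by auto
        then have "((\<lambda>t. (1 - t) * ln (t - 1) + t) has_real_derivative - ln \<bar>1 - t\<bar>) (at t)"
          by (auto intro!: derivative_eq_intros simp: divide_simps)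
        then show ?thesis
          by (rule has_field_derivative_transform_within_open[of _ _ _ "{1<..}"]) (use \<open>t > 1\<close> in auto)
      qed
      have 2: "((\<lambda>t. pi * min 0 (1 - t)) has_real_derivative - ?c) (at t)"
      proof (cases "t < 1")
        case True
        have "((\<lambda>t. 0) has_real_derivative - ?c) (at t)" using True by auto
        then show ?thesis
          by (rule has_field_derivative_transform_within_open[of _ _ _ "{..<1}"]) (use True in auto)
      next
        case False
        then have "t > 1" using t by auto
        then have "((\<lambda>t. pi * (1 - t)) has_real_derivative - ?c) (at t)"
          by (auto intro!: derivative_eq_intros)
        then show ?thesis
          by (rule has_field_derivative_transform_within_open[of _ _ _ "{1<..}"]) (use \<open>t > 1\<close> in auto)
      qed
      have "(?A has_vector_derivative (of_real (- ln \<bar>1 - t\<bar>) + \<i> * of_real (- ?c))) (at t)"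
        by (intro has_vector_derivative_add has_vector_derivative_mult_right
            has_vector_derivative_of_real 1 2)
      then show ?thesis
        using Ln_of_real_cases[of "1 - t"] t by (simp split: if_splits)
    qed
    show "(\<lambda>t. ?A t * (- 1 / (complex_of_real t)\<^sup>2)) integrable_on {1 / 2..b}"
      by (intro integrable_continuous_real continuous_intros continuous_on_subset[OF A]) auto
  qed (use assms in auto)
  then show ?thesis by simp
qed

text \<open>For \<open>x > 1\<close> the contour runs along the cut itself. Regularity there becomes
  a question about an indefinite integral in one real variable.\<close>

lemma polylog_cont_Suc_of_real:
  assumes "s \<ge> 1" "x \<ge> 0"
  shows "polylog_cont (Suc s) (of_real x) = integral {0..x} (\<lambda>t. polylog_cont s (of_real t) / of_real t)"
proof (cases "x = 0")
  case False
  obtain t where s: "s = Suc t" using assms by (cases s) auto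
  show ?thesis unfolding s polylog_cont.simps
    by (subst contour_integral_linepath_Reals_eq) (use assms False in auto)
qed (simp add: polylog_cont_0_right)

lemma isCont_polylog_cont: "s \<ge> 1 \<Longrightarrow> x \<in> slit_plane \<Longrightarrow> isCont (polylog_cont s) x"
  using holomorphic_on_imp_continuous_on[OF holomorphic_polylog_cont[of s]]
  by (auto simp: continuous_on_eq_continuous_at open_slit_plane)

text \<open>The next order is a primitive, continuous up to the endpoints. The fundamental theorem
  asks for the derivative only in the interior, so the quotient at \<open>t = 0\<close> does no
  harm.\<close>

lemma integrable_polylog_cont_near_0:
  assumes "s \<ge> 1"
  shows "(\<lambda>t. polylog_cont s (of_real t) / of_real t) integrable_on {0..1/2}"
proof (rule has_integral_integrable, rule fundamental_theorem_of_calculus_interior)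
  show "continuous_on {0..1/2} (\<lambda>t. polylog_cont (Suc s) (of_real t))"
    by (rule continuous_on_compose2[OF holomorphic_on_imp_continuous_on[OF holomorphic_polylog_cont]])
      (auto simp: in_slit_plane_iff intro!: continuous_intros)
  show "((\<lambda>t. polylog_cont (Suc s) (of_real t)) has_vector_derivative
      polylog_cont s (of_real t) / of_real t) (at t)" if "t \<in> {0<..<1/2}" for t
    by (rule has_vector_derivative_real_field, rule has_field_derivative_polylog_cont)
      (use assms that in \<open>auto simp: in_slit_plane_iff\<close>)
qed auto

text \<open>Integrability at order \<open>s\<close> makes the indefinite integral
  \<open>Li_(s+1)\<close> continuous along the reals, and continuity makes the next integrand
  integrable away from \<open>0\<close>. The induction starts from the integration by parts for
  \<open>Ln\<close>.\<close>

lemma polylog_cont_of_real: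
  assumes "s \<ge> 1"
  shows integrable_polylog_cont: "(\<lambda>t. polylog_cont s (of_real t) / of_real t) integrable_on {0..b}"
    and continuous_on_polylog_cont_of_real: "continuous_on {0..b} (\<lambda>t. polylog_cont (Suc s) (of_real t))"
proof -
  have cont: "continuous_on {0..b} (\<lambda>t. polylog_cont (Suc s) (of_real t))"
    if "s \<ge> 1" "(\<lambda>t. polylog_cont s (of_real t) / of_real t) integrable_on {0..b}" for s b
    by (rule continuous_on_eq[OF indefinite_integral_continuous_1[OF that(2)]])
      (use polylog_cont_Suc_of_real[OF that(1)] in auto)
  \<comment> \<open>Integrability near \<open>0\<close> and away from \<open>0\<close> have
    different causes; the two pieces are glued at \<open>1/2\<close>.\<close>
  have extend: "(\<lambda>t. polylog_cont s (of_real t) / of_real t) integrable_on {0..b}"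
    if "s \<ge> 1" "\<And>b. b \<ge> 1/2 \<Longrightarrow> (\<lambda>t. polylog_cont s (of_real t) / of_real t) integrable_on {1/2..b}" for s b
  proof -
    have "(\<lambda>t. polylog_cont s (of_real t) / of_real t) integrable_on {0..max b (1/2)}"
      by (rule Henstock_Kurzweil_Integration.integrable_combine[where c = "1/2"])
        (use that integrable_polylog_cont_near_0[of s] in auto)
    then show ?thesis by (rule integrable_on_subinterval) auto
  qed
  have int: "(\<lambda>t. polylog_cont s (of_real t) / of_real t) integrable_on {0..b}" for b
    using assms
  proof (induction s arbitrary: b rule: dec_induct)
    case base
    show ?case by (rule extend) (use integrable_Ln_one_minus_over in auto)
  next
    case (step s)
    have "continuous_on {1/2..b} (\<lambda>t. polylog_cont (Suc s) (of_real t))" for b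
      by (rule continuous_on_subset[OF cont[of s b]]) (use step in auto)
    then show ?case
      by (intro extend integrable_continuous_real continuous_intros) auto
  qed
  then show "(\<lambda>t. polylog_cont s (of_real t) / of_real t) integrable_on {0..b}" .
  show "continuous_on {0..b} (\<lambda>t. polylog_cont (Suc s) (of_real t))"
    using cont int assms by blast
qed

lemma isCont_polylog_cont_of_real:
  assumes "s \<ge> 2" "x > 0"
  shows "isCont (\<lambda>t. polylog_cont s (of_real t)) x"
proof -
  obtain t where s: "s = Suc t" "t \<ge> 1" using assms by (cases s) auto
  have "continuous_on {0<..<x+1} (\<lambda>t. polylog_cont s (of_real t))"
    by (rule continuous_on_subset[of "{0..x+1}"]) (use continuous_on_polylog_cont_of_real s in auto)
  then show ?thesis using assms by (simp add: continuous_on_eq_continuous_at)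
qed

text \<open>At order one, \<open>Ln (1 - t)\<close> equals \<open>ln (t - 1) + i pi\<close> for all
  real \<open>t > 1\<close>, so it is continuous along the cut although the complex function jumps
  across it.\<close>

lemma isCont_polylog_cont_of_real_gt_1:
  assumes "s \<ge> 1" "x > 1"
  shows "isCont (\<lambda>t. polylog_cont s (of_real t)) x"
proof (cases "s = 1")
  case True
  have "isCont (\<lambda>t. - (of_real (ln (t - 1)) + \<i> * of_real pi)) x"
    using assms by (intro continuous_intros) auto
  moreover have "\<forall>\<^sub>F t in nhds x. - (of_real (ln (t - 1)) + \<i> * of_real pi) = - Ln (1 - of_real t)"
  proof -
    have "\<forall>\<^sub>F t in nhds x. t \<in> {1<..}"
      by (rule eventually_nhds_in_open) (use assms in auto)
    then show ?thesis
    proof eventually_elim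
      case (elim t)
      then show ?case using Ln_of_real_cases[of "1 - t"] by auto
    qed
  qed
  ultimately show ?thesis using True by (simp add: isCont_cong)
qed (use isCont_polylog_cont_of_real assms in auto)

text \<open>The integrand is continuous along the reals beyond \<open>1\<close>, so the fundamental
  theorem of calculus gives the recursion as a one-variable derivative on the cut.\<close>

lemma has_vector_derivative_polylog_cont_of_real:
  assumes "s \<ge> 1" "x > 1"
  shows "((\<lambda>t. polylog_cont (Suc s) (of_real t)) has_vector_derivative
           polylog_cont s (of_real x) / of_real x) (at x)"
proof -
  let ?f = "\<lambda>t. polylog_cont s (of_real t) / of_real t"
  have "isCont ?f x"
    by (intro continuous_divide isCont_polylog_cont_of_real_gt_1 isCont_of_real continuous_ident)
      (use assms in auto)
  then have "((\<lambda>u. integral {0..u} ?f) has_vector_derivative ?f x) (at x within ({0..x+1} - {}))"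
    by (intro integral_has_vector_derivative_continuous_at[OF integrable_polylog_cont])
      (use assms in \<open>auto intro: continuous_within_subset\<close>)
  then have "((\<lambda>u. integral {0..u} ?f) has_vector_derivative ?f x) (at x)"
    using assms by (simp add: at_within_Icc_at)
  then show ?thesis
    by (rule has_vector_derivative_transform_within_open[of _ _ _ "{0<..}"])
      (use assms polylog_cont_Suc_of_real in auto)
qed

text \<open>Only \<open>x = 1\<close> is delicate: it lies on the unit circle and is the branch
  point. There both sides are limits from the left of functions that agree on
  \<open>(0,1)\<close>.\<close>

lemma polylog_of_real_eq_polylog_cont:
  assumes "s \<ge> 2" "x > 0"
  shows "polylog s (of_real x) = polylog_cont s (of_real x)"
proof (cases "x = 1")
  case True
  have "polylog_series s 1 = polylog_cont s 1"
  proof (rule tendsto_unique)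
    let ?F = "at_left (1::real)"
    have ev: "\<forall>\<^sub>F r in ?F. r \<in> {0<..<1}"
      by (rule eventually_at_leftI[of 0]) auto
    have lim: "((\<lambda>r. of_real r) \<longlongrightarrow> (1::complex)) ?F"
      by (auto intro!: tendsto_eq_intros)
    show "((\<lambda>r. polylog_series s (of_real r)) \<longlongrightarrow> polylog_series s 1) ?F"
      by (rule continuous_on_tendsto_compose[OF continuous_on_polylog_series lim])
        (use assms ev in \<open>auto elim!: eventually_mono\<close>)
    have "((\<lambda>r. polylog_cont s (of_real r)) \<longlongrightarrow> polylog_cont s 1) ?F"
      using isCont_polylog_cont_of_real[of s 1] assms
      by (auto simp: isCont_def filterlim_at_split)
    then show "((\<lambda>r. polylog_series s (of_real r)) \<longlongrightarrow> polylog_cont s 1) ?F"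
      by (rule Lim_transform_eventually)
        (use ev in eventually_elim, use polylog_cont_eq_series assms in auto)
  qed auto
  then show ?thesis using polylog_eq_series[of s 1] assms True by auto
next
  case False
  then show ?thesis
    using polylog_eq_polylog_cont[of s "of_real x"] assms by (cases "x < 1") (auto simp: in_slit_plane_iff polylog_def)
qed

subsection \<open>The generating function of the even zeta values\<close>

lemma summable_zeta:
  assumes "s \<ge> 2"
  shows "summable (\<lambda>k. 1 / real (Suc k) ^ s)"
  using inverse_power_summable[OF assms, where 'a = real]
  by (subst summable_Suc_iff) (simp add: field_simps)

lemma riemann_zeta_bounds:
  assumes "s \<ge> 2"
  shows "0 \<le> riemann_zeta s" "riemann_zeta s \<le> riemann_zeta 2"
proof -
  show "0 \<le> riemann_zeta s" unfolding riemann_zeta_def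
    by (intro suminf_nonneg summable_zeta assms) auto
  show "riemann_zeta s \<le> riemann_zeta 2" unfolding riemann_zeta_def
    by (intro suminf_le summable_zeta assms order.refl frac_le power_increasing) auto
qed

text \<open>Division by zero makes the coefficient at \<open>k = 0\<close> vanish.\<close>

definition zeta_coeff :: "nat \<Rightarrow> complex" where
  "zeta_coeff k = (-1) ^ k * of_real (riemann_zeta (2 * k)) / of_nat k"

lemma norm_zeta_coeff: "norm (zeta_coeff k) \<le> riemann_zeta 2 / real k"
  using riemann_zeta_bounds[of "2 * k"]
  by (cases "k = 0") (auto simp: zeta_coeff_def norm_mult norm_divide norm_power divide_right_mono)

text \<open>At \<open>w = z^2\<close> this is \<open>G(z)\<close>; in the variable \<open>w\<close>
  it is an ordinary power series.\<close>

definition zeta_gen :: "complex \<Rightarrow> complex" where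
  "zeta_gen w = (\<Sum>k. zeta_coeff k * w ^ k)"

text \<open>At \<open>w = z^2\<close> this is the series of the theorem. The denominator
  \<open>2 * k + n\<close> is what integrating \<open>z^(n-1) G(z)\<close> term by term
  produces.\<close>

definition zeta_gen_weighted :: "nat \<Rightarrow> complex \<Rightarrow> complex" where
  "zeta_gen_weighted n w = (\<Sum>k. zeta_coeff k / of_nat (2 * k + n) * w ^ k)"

lemma summable_zeta_gen:
  assumes "norm w < 1"
  shows "summable (\<lambda>k. zeta_coeff k * w ^ k)"
proof (rule summable_comparison_test')
  show "summable (\<lambda>k. riemann_zeta 2 * norm w ^ k)"
    using assms by (intro summable_mult summable_geometric) auto
  show "norm (zeta_coeff k * w ^ k) \<le> riemann_zeta 2 * norm w ^ k" if "k \<ge> 1" for k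
  proof -
    have "riemann_zeta 2 * 1 \<le> riemann_zeta 2 * real k"
      using riemann_zeta_bounds[of 2] that by (intro mult_left_mono) auto
    then have "riemann_zeta 2 / real k \<le> riemann_zeta 2"
      using that by (simp add: divide_simps)
    then show ?thesis
      using norm_zeta_coeff[of k] by (auto simp: norm_mult norm_power intro!: mult_right_mono)
  qed
qed

text \<open>The extra denominator improves the decay to \<open>1 / k^2\<close>, uniformly on the
  closed disc, which later permits the passage to the unit circle.\<close>

lemma norm_zeta_gen_weighted_term:
  assumes "norm w \<le> 1"
  shows "norm (zeta_coeff k / of_nat (2 * k + n) * w ^ k) \<le> riemann_zeta 2 * (1 / real k ^ 2)"
proof (cases "k = 0")
  case False
  have "norm (zeta_coeff k) / real (2 * k + n) \<le> (riemann_zeta 2 / real k) / real k"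
    using norm_zeta_coeff[of k] riemann_zeta_bounds[of 2] False by (intro frac_le) auto
  moreover have "norm w ^ k \<le> 1" using assms by (simp add: power_le_one)
  ultimately have "norm (zeta_coeff k) / real (2 * k + n) * norm w ^ k
      \<le> ((riemann_zeta 2 / real k) / real k) * 1"
    by (intro mult_mono) (use riemann_zeta_bounds[of 2] in auto)
  moreover have "norm (zeta_coeff k / of_nat (2 * k + n) * w ^ k)
      = norm (zeta_coeff k) / real (2 * k + n) * norm w ^ k"
    by (simp only: norm_mult norm_divide norm_power norm_of_nat)
  ultimately show ?thesis by (simp add: power2_eq_square)
qed (auto simp: zeta_coeff_def)

lemma summable_zeta_gen_weighted:
  assumes "norm w \<le> 1"
  shows "summable (\<lambda>k. zeta_coeff k / of_nat (2 * k + n) * w ^ k)"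
  by (rule summable_comparison_test'[OF summable_mult[OF summable_inverse_power2], of 0])
    (use norm_zeta_gen_weighted_term assms in auto)

lemma continuous_on_zeta_gen_weighted: "continuous_on (cball 0 1) (zeta_gen_weighted n)"
  unfolding zeta_gen_weighted_def
proof (rule uniform_limit_theorem)
  show "uniform_limit (cball 0 1) (\<lambda>N w. \<Sum>k<N. zeta_coeff k / of_nat (2 * k + n) * w ^ k)
          (\<lambda>w. \<Sum>k. zeta_coeff k / of_nat (2 * k + n) * w ^ k) sequentially"
    by (rule Weierstrass_m_test[OF _ summable_mult[OF summable_inverse_power2]])
      (use norm_zeta_gen_weighted_term in auto)
qed (auto intro!: always_eventually continuous_on_sum continuous_on_mult[OF continuous_on_const]
    continuous_on_power continuous_on_id simp del: times_divide_eq_left)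

lemma holomorphic_zeta_gen: "zeta_gen holomorphic_on ball 0 1"
proof -
  have "(zeta_gen has_field_derivative (\<Sum>k. diffs zeta_coeff k * w ^ k)) (at w)" if "norm w < 1" for w
    unfolding zeta_gen_def
    by (rule termdiffs_strong'[of 1]) (use that summable_zeta_gen in auto)
  then show ?thesis by (subst holomorphic_on_open) (simp, force)
qed

text \<open>The terms of the product are multiples of \<open>z^(2k+n) / (2k+n)\<close>, and
  differentiation cancels the denominator.\<close>

lemma has_field_derivative_zeta_gen_weighted:
  assumes "n \<ge> 1" "norm z < 1"
  shows "((\<lambda>z. z ^ n * zeta_gen_weighted n (z ^ 2)) has_field_derivative
           z ^ (n - 1) * zeta_gen (z ^ 2)) (at z)"
proof -
  let ?c = "\<lambda>k. zeta_coeff k / of_nat (2 * k + n)"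
  define d where "d = (\<lambda>w. \<Sum>k. diffs ?c k * w ^ k)"
  have z2: "norm (z ^ 2) < 1" using assms by (simp add: norm_power power_less_one_iff)
  have d: "(zeta_gen_weighted n has_field_derivative d (z ^ 2)) (at (z ^ 2))"
    unfolding zeta_gen_weighted_def d_def
    by (rule termdiffs_strong'[of 1]) (use z2 summable_zeta_gen_weighted in auto)
  \<comment> \<open>This is the Euler operator \<open>w d/dw\<close> at \<open>w = z^2\<close>,
    which multiplies the \<open>k\<close>-th term by \<open>k\<close>. Combined below as
    \<open>n + 2 * k\<close>, it removes the denominator.\<close>
  have "(\<lambda>k. of_nat k * ?c k * (z ^ 2) ^ k) sums (z ^ 2 * d (z ^ 2))"
  proof -
    have "summable (\<lambda>k. diffs ?c k * (z ^ 2) ^ k)"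
      by (rule termdiff_converges[of _ 1]) (use z2 summable_zeta_gen_weighted in auto)
    then have "(\<lambda>k. z ^ 2 * (diffs ?c k * (z ^ 2) ^ k)) sums (z ^ 2 * d (z ^ 2))"
      unfolding d_def by (intro sums_mult summable_sums)
    moreover have "z ^ 2 * (diffs ?c k * (z ^ 2) ^ k) = of_nat (Suc k) * ?c (Suc k) * (z ^ 2) ^ Suc k" for k
      by (simp only: diffs_def power_Suc mult_ac)
    ultimately have "(\<lambda>k. of_nat (Suc k) * ?c (Suc k) * (z ^ 2) ^ Suc k) sums (z ^ 2 * d (z ^ 2))"
      by (simp only:)
    then show ?thesis
      by (subst (asm) sums_Suc_iff) simp
  qed
  then have "(\<lambda>k. of_nat n * (?c k * (z ^ 2) ^ k) + 2 * (of_nat k * ?c k * (z ^ 2) ^ k)) sums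
      (of_nat n * zeta_gen_weighted n (z ^ 2) + 2 * (z ^ 2 * d (z ^ 2)))"
    unfolding zeta_gen_weighted_def
    by (intro sums_add sums_mult summable_sums summable_zeta_gen_weighted) (use z2 in auto)
  moreover have "of_nat n * (?c k * (z ^ 2) ^ k) + 2 * (of_nat k * ?c k * (z ^ 2) ^ k)
      = zeta_coeff k * (z ^ 2) ^ k" for k
  proof -
    have "of_nat (2 * k + n) \<noteq> (0 :: complex)" using assms by (simp del: of_nat_add)
    then have "?c k * of_nat (2 * k + n) = zeta_coeff k" by (rule nonzero_eq_divide_eq[THEN iffD1, OF _ refl])
    then have "zeta_coeff k * (z ^ 2) ^ k = ?c k * of_nat (2 * k + n) * (z ^ 2) ^ k" by (simp only:)
    also have "\<dots> = of_nat n * (?c k * (z ^ 2) ^ k) + 2 * (of_nat k * ?c k * (z ^ 2) ^ k)"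
      by (simp only: of_nat_add of_nat_mult of_nat_numeral) algebra
    finally show ?thesis by simp
  qed
  ultimately have eq: "zeta_gen (z ^ 2) = of_nat n * zeta_gen_weighted n (z ^ 2) + 2 * (z ^ 2 * d (z ^ 2))"
    unfolding zeta_gen_def by (simp add: sums_iff)
  have "((\<lambda>z. zeta_gen_weighted n (z ^ 2)) has_field_derivative d (z ^ 2) * (2 * z)) (at z)"
    by (rule DERIV_chain2[where g = "\<lambda>z. z ^ 2", OF d]) (auto intro!: derivative_eq_intros)
  then have "((\<lambda>z. z ^ n * zeta_gen_weighted n (z ^ 2)) has_field_derivative
      of_nat n * z ^ (n - 1) * zeta_gen_weighted n (z ^ 2) + z ^ n * (d (z ^ 2) * (2 * z))) (at z)"
    by (auto intro!: derivative_eq_intros)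
  moreover have "z ^ n = z ^ (n - 1) * z" using assms by (cases n) auto
  ultimately show ?thesis unfolding eq by (simp add: algebra_simps power2_eq_square)
qed

text \<open>Truncating the zeta sums at \<open>M\<close> turns the generating function into minus a
  finite sum of \<open>Ln (1 + z^2 / m^2)\<close>. Exponentiating and letting \<open>M\<close> grow
  gives Euler's sine product at \<open>i z\<close>. The factor \<open>pi z\<close> is kept on the
  left so that \<open>z = 0\<close> is covered.\<close>

lemma exp_zeta_gen:
  assumes "norm z < 1"
  shows "exp (- zeta_gen (z ^ 2)) * (of_real pi * z) = (exp (of_real pi * z) - exp (- of_real pi * z)) / 2"
proof -
  \<comment> \<open>\<open>a k M\<close> is the \<open>k\<close>-th term of
    \<open>zeta_gen (z ^ 2)\<close> with the zeta value cut off after \<open>M\<close>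
    summands.\<close>
  define a where "a = (\<lambda>k M. \<Sum>m=1..M. (- (z ^ 2 / of_nat m ^ 2)) ^ k / of_nat k)"
  have z2: "norm (z ^ 2) < 1" using assms by (simp add: norm_power power_less_one_iff)
  have lt1: "norm (z ^ 2 / of_nat m ^ 2) < 1" if "m \<ge> 1" for m
  proof -
    have "norm (z ^ 2 / of_nat m ^ 2) \<le> norm (z ^ 2) / 1"
      unfolding norm_divide using that by (intro divide_left_mono) (auto simp: norm_power)
    then show ?thesis using z2 by simp
  qed
  have a_sums: "(\<lambda>k. a k M) sums (- (\<Sum>m=1..M. Ln (1 + z ^ 2 / of_nat m ^ 2)))" for M
    unfolding a_def sum_negf[symmetric]
  proof (rule sums_sum)
    fix m assume "m \<in> {1..M}"
    then show "(\<lambda>k. (- (z ^ 2 / of_nat m ^ 2)) ^ k / of_nat k) sums (- Ln (1 + z ^ 2 / of_nat m ^ 2))"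
      using sums_minus[OF Ln_series'[OF lt1[of m]]] by simp
  qed
  have zeta_sums: "(\<lambda>M. \<Sum>m=1..M. 1 / real m ^ s) \<longlonglongrightarrow> riemann_zeta s" if "s \<ge> 2" for s
  proof -
    have "(\<lambda>M. \<Sum>k<M. 1 / real (Suc k) ^ s) \<longlonglongrightarrow> riemann_zeta s"
      unfolding riemann_zeta_def using summable_LIMSEQ[OF summable_zeta[OF that]] .
    moreover have "(\<Sum>k<M. 1 / real (Suc k) ^ s) = (\<Sum>m=1..M. 1 / real m ^ s)" for M
      by (rule sum.reindex_bij_witness[of _ "\<lambda>m. m - 1" Suc]) auto
    ultimately show ?thesis by simp
  qed
  have a_eq: "a k M = (- 1) ^ k * (z ^ 2) ^ k / of_nat k * of_real (\<Sum>m=1..M. 1 / real m ^ (2 * k))" for k M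
    unfolding a_def of_real_sum sum_distrib_left
    by (intro sum.cong refl) (simp add: power_minus[of "_ / _"] power_divide power_mult)
  have lim: "(\<lambda>M. a k M) \<longlonglongrightarrow> zeta_coeff k * (z ^ 2) ^ k" for k
  proof (cases "k = 0")
    case False
    have "(\<lambda>M. a k M) \<longlonglongrightarrow> (- 1) ^ k * (z ^ 2) ^ k / of_nat k * of_real (riemann_zeta (2 * k))"
      unfolding a_eq by (intro tendsto_intros zeta_sums) (use False in auto)
    then show ?thesis by (simp add: zeta_coeff_def mult_ac)
  qed (simp add: a_eq zeta_coeff_def)
  have bound: "norm (a k M) \<le> riemann_zeta 2 * norm (z ^ 2) ^ k" for k M
  proof (cases "k = 0")
    case False
    have "(\<Sum>m=1..M. 1 / real m ^ (2 * k)) \<le> (\<Sum>m=1..M. 1 / real m ^ 2)"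
      by (intro sum_mono frac_le power_increasing) (use False in auto)
    also have "\<dots> \<le> riemann_zeta 2"
    proof (rule incseq_le[OF _ zeta_sums])
      show "incseq (\<lambda>M. \<Sum>m=1..M. 1 / real m ^ 2)"
        by (auto intro!: incseq_SucI)
    qed auto
    finally have 1: "(\<Sum>m=1..M. 1 / real m ^ (2 * k)) \<le> riemann_zeta 2" .
    have 2: "norm (z ^ 2) ^ k / real k \<le> norm (z ^ 2) ^ k"
      using False by (simp add: divide_le_eq mult_left_le_one_le mult_le_cancel_left1)
    have "norm (a k M) = norm (z ^ 2) ^ k / real k * (\<Sum>m=1..M. 1 / real m ^ (2 * k))"
      unfolding a_eq norm_mult norm_divide norm_power norm_of_real
      by (subst abs_of_nonneg) (auto intro!: sum_nonneg)
    also have "\<dots> \<le> norm (z ^ 2) ^ k * riemann_zeta 2"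
      by (intro mult_mono 1 2 sum_nonneg) auto
    finally show ?thesis by (simp add: mult.commute)
  qed (use riemann_zeta_bounds[of 2] in \<open>auto simp: a_eq\<close>)
  \<comment> \<open>Tannery's theorem exchanges the limit in \<open>M\<close> with the sum over
    \<open>k\<close>; the geometric majorant \<open>zeta(2) |z|^(2k)\<close> does not depend on
    \<open>M\<close>.\<close>
  have "((\<lambda>M. \<Sum>k. a k M) \<longlonglongrightarrow> (\<Sum>k. zeta_coeff k * (z ^ 2) ^ k))"
    by (rule tannerys_theorem[where M = "\<lambda>k. riemann_zeta 2 * norm (z ^ 2) ^ k", OF lim,
          THEN conjunct2, THEN conjunct2])
      (use bound z2 in \<open>auto intro!: always_eventually summable_mult summable_geometric\<close>)
  then have "(\<lambda>M. - (\<Sum>m=1..M. Ln (1 + z ^ 2 / of_nat m ^ 2))) \<longlonglongrightarrow> zeta_gen (z ^ 2)"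
    using a_sums by (simp add: sums_iff zeta_gen_def)
  then have "(\<lambda>M. exp (- (- (\<Sum>m=1..M. Ln (1 + z ^ 2 / of_nat m ^ 2)))) * (of_real pi * (\<i> * z)))
      \<longlonglongrightarrow> exp (- zeta_gen (z ^ 2)) * (of_real pi * (\<i> * z))"
    by (intro tendsto_intros)
  moreover have "exp (- (- (\<Sum>m=1..M. Ln (1 + z ^ 2 / of_nat m ^ 2)))) * (of_real pi * (\<i> * z))
      = of_real pi * (\<i> * z) * (\<Prod>m=1..M. 1 - (\<i> * z) ^ 2 / of_nat m ^ 2)" for M
  proof -
    have "exp (Ln (1 + z ^ 2 / of_nat m ^ 2)) = 1 - (\<i> * z) ^ 2 / of_nat m ^ 2" if "m \<in> {1..M}" for m
    proof -
      have "1 + z ^ 2 / of_nat m ^ 2 \<noteq> 0"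
      proof
        assume "1 + z ^ 2 / of_nat m ^ 2 = 0"
        then have "norm (z ^ 2 / of_nat m ^ 2) = norm (- 1 :: complex)"
          by (metis add_eq_0_iff)
        then show False using lt1[of m] that by auto
      qed
      then show ?thesis by (simp add: power_mult_distrib)
    qed
    then show ?thesis by (simp add: exp_sum)
  qed
  ultimately have "(\<lambda>M. of_real pi * (\<i> * z) * (\<Prod>m=1..M. 1 - (\<i> * z) ^ 2 / of_nat m ^ 2))
      \<longlonglongrightarrow> exp (- zeta_gen (z ^ 2)) * (of_real pi * (\<i> * z))"
    by (simp only:)
  then have "exp (- zeta_gen (z ^ 2)) * (of_real pi * (\<i> * z)) = sin (of_real pi * (\<i> * z))"
    using sin_product_formula_complex[of "\<i> * z"] by (rule LIMSEQ_unique)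
  also have "\<dots> = \<i> * ((exp (of_real pi * z) - exp (- of_real pi * z)) / 2)"
    using sin_i_times[of "of_real pi * z"] by (simp add: mult.left_commute exp_minus)
  finally have "\<i> * (exp (- zeta_gen (z ^ 2)) * (of_real pi * z))
      = \<i> * ((exp (of_real pi * z) - exp (- of_real pi * z)) / 2)"
    by (simp only: mult_ac)
  then show ?thesis by (simp only: mult_left_cancel[OF complex_i_not_zero])
qed

text \<open>A real value forces \<open>Im z = k / 2\<close> with \<open>k\<close> among
  \<open>-1, 0, 1\<close>. For \<open>k = 1\<close> or \<open>-1\<close> the value is negative; for
  \<open>k = 0\<close> a value of at least \<open>1\<close> would put \<open>z\<close> on the
  nonpositive reals.\<close>

lemma exp_in_slit_plane:
  assumes "\<bar>Im z\<bar> < 1" "z \<notin> \<real>\<^sub>\<le>\<^sub>0"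
  shows "exp (- 2 * of_real pi * z) \<in> slit_plane"
proof (rule ccontr)
  assume "exp (- 2 * of_real pi * z) \<notin> slit_plane"
  then have *: "sin (2 * pi * Im z) = 0" "exp (- 2 * pi * Re z) * cos (2 * pi * Im z) \<ge> 1"
    by (auto simp: in_slit_plane_iff Re_exp Im_exp)
  then obtain k :: int where k: "2 * pi * Im z = of_int k * pi"
    by (auto simp: sin_zero_iff_int2)
  then have Im: "Im z = of_int k / 2" by (simp add: field_simps)
  have "\<bar>k\<bar> < 2" using assms(1) unfolding Im by linarith
  then have "k = 0 \<or> k = 1 \<or> k = - 1" by linarith
  moreover have False if "k = 1 \<or> k = - 1"
  proof -
    have "cos (2 * pi * Im z) = - 1" unfolding k using that by auto
    with *(2) have "1 \<le> - exp (- 2 * pi * Re z)" by simp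
    then show False using exp_gt_zero[of "- 2 * pi * Re z"] by linarith
  qed
  moreover have False if "k = 0"
  proof -
    have "Re z > 0" using Im that assms(2) by (auto simp: complex_nonpos_Reals_iff)
    moreover have "exp (- 2 * pi * Re z) \<ge> 1" using *(2) Im that by simp
    ultimately show False using pi_gt_zero by (simp add: mult_le_0_iff not_le)
  qed
  ultimately show False by blast
qed

text \<open>In the closed disc only \<open>i\<close> and \<open>-i\<close> have imaginary part of
  modulus one, and the second hypothesis excludes both.\<close>

lemma abs_Im_less_one:
  assumes "norm z \<le> 1" "Re z \<noteq> 0 \<or> norm z < 1"
  shows "\<bar>Im z\<bar> < 1"
proof (rule ccontr)
  assume "\<not> \<bar>Im z\<bar> < 1"
  then have "1 \<le> (Im z)\<^sup>2" by (simp add: power2_ge_1_iff abs_if split: if_splits)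
  moreover have "(norm z)\<^sup>2 = (Re z)\<^sup>2 + (Im z)\<^sup>2" by (rule cmod_power2)
  moreover have "(norm z)\<^sup>2 < 1 \<or> (norm z)\<^sup>2 \<le> 1 \<and> (Re z)\<^sup>2 > 0"
    using assms by (auto simp: power_le_one power_less_one_iff)
  ultimately show False using zero_le_power2[of "Re z"] by linarith
qed

section \<open>The slit disc and the logarithmic form of the generating function\<close>

definition slit_disc :: "complex set" where
  "slit_disc = ball 0 1 - \<real>\<^sub>\<le>\<^sub>0"

lemma open_slit_disc: "open slit_disc"
  unfolding slit_disc_def by (intro open_Diff) auto

text \<open>The set is star-shaped about the positive point \<open>1/2\<close>: a segment from there
  can meet the nonpositive axis only if its other endpoint is real, hence positive, which is
  absurd.\<close>

lemma connected_slit_disc: "connected slit_disc"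
proof (rule starlike_imp_connected, unfold starlike_def, intro bexI ballI)
  show half: "1/2 \<in> slit_disc" by (auto simp: slit_disc_def complex_nonpos_Reals_iff)
  fix z assume z: "z \<in> slit_disc"
  have "closed_segment (1/2) z \<subseteq> ball 0 1"
    by (rule closed_segment_subset) (use z half in \<open>auto simp: slit_disc_def\<close>)
  moreover have "y \<notin> \<real>\<^sub>\<le>\<^sub>0" if y: "y \<in> closed_segment (1/2) z" for y
  proof
    assume "y \<in> \<real>\<^sub>\<le>\<^sub>0"
    moreover obtain u where u: "0 \<le> u" "u \<le> 1" "y = (1 - u) *\<^sub>R (1/2) + u *\<^sub>R z"
      using y by (auto simp: in_segment)
    ultimately have *: "u * Im z = 0" "(1 - u) / 2 + u * Re z \<le> 0"
      by (auto simp: complex_nonpos_Reals_iff)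
    then have "u \<noteq> 0" by auto
    then have "Im z = 0" using * by auto
    then have "Re z > 0" using z by (auto simp: slit_disc_def complex_nonpos_Reals_iff)
    then have "u * Re z > 0" using u \<open>u \<noteq> 0\<close> by auto
    then show False using * u by (simp add: field_simps)
  qed
  ultimately show "closed_segment (1/2) z \<subseteq> slit_disc" by (auto simp: slit_disc_def)
qed

lemma exp_in_slit_plane_slit_disc: "z \<in> slit_disc \<Longrightarrow> exp (- 2 * of_real pi * z) \<in> slit_plane"
  by (intro exp_in_slit_plane abs_Im_less_one) (auto simp: slit_disc_def)

lemma two_pi_mult_nonpos_Reals_iff: "2 * complex_of_real pi * z \<in> \<real>\<^sub>\<le>\<^sub>0 \<longleftrightarrow> z \<in> \<real>\<^sub>\<le>\<^sub>0"
  using pi_gt_zero by (auto simp: complex_nonpos_Reals_iff mult_le_0_iff not_le simp del: pi_gt_zero)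

lemma Im_zeta_gen_of_real: "norm (of_real x :: complex) < 1 \<Longrightarrow> Im (zeta_gen (of_real x)) = 0"
proof -
  assume "norm (of_real x :: complex) < 1"
  then have "(\<lambda>k. Im (zeta_coeff k * of_real x ^ k)) sums Im (zeta_gen (of_real x))"
    unfolding zeta_gen_def
    by (intro sums_Im summable_sums summable_zeta_gen)
  moreover have "zeta_coeff k * of_real x ^ k = of_real ((-1) ^ k * riemann_zeta (2 * k) / real k * x ^ k)" for k
    by (simp add: zeta_coeff_def)
  ultimately show ?thesis by (simp add: sums_iff del: of_real_mult of_real_divide)
qed

text \<open>Both sides have the same exponential by the product formula. Their difference is
  therefore a constant multiple of \<open>2 pi i\<close> on a connected set, and it is real at one
  point.\<close>

lemma zeta_gen_slit_disc:
  assumes "z \<in> slit_disc"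
  shows "zeta_gen (z ^ 2) = - of_real pi * z + Ln (2 * of_real pi * z) - Ln (1 - exp (- 2 * of_real pi * z))"
proof -
  define D where "D = (\<lambda>z. zeta_gen (z ^ 2) -
    (- of_real pi * z + Ln (2 * of_real pi * z) - Ln (1 - exp (- 2 * of_real pi * z))))"
  have nz: "z \<noteq> 0" "norm z < 1" "2 * of_real pi * z \<notin> \<real>\<^sub>\<le>\<^sub>0" "1 - exp (- 2 * of_real pi * z) \<notin> \<real>\<^sub>\<le>\<^sub>0"
    if "z \<in> slit_disc" for z
  proof -
    show "z \<noteq> 0" "norm z < 1" using that by (auto simp: slit_disc_def)
    show "2 * of_real pi * z \<notin> \<real>\<^sub>\<le>\<^sub>0"
      unfolding two_pi_mult_nonpos_Reals_iff using that by (auto simp: slit_disc_def)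
    show "1 - exp (- 2 * of_real pi * z) \<notin> \<real>\<^sub>\<le>\<^sub>0"
      using exp_in_slit_plane_slit_disc[OF that]
      by (auto simp: in_slit_plane_iff complex_nonpos_Reals_iff)
  qed
  have expD: "exp (D z) = 1" if z: "z \<in> slit_disc" for z
  proof -
    have ne: "1 - exp (- 2 * of_real pi * z) \<noteq> 0" using nz(4)[OF z] by auto
    define p where "p = of_real pi * z"
    have p2: "exp (- 2 * of_real pi * z) = exp (- p) * exp (- p)"
      by (simp add: p_def mult_ac flip: exp_add)
    have "of_real pi * z = exp (zeta_gen (z ^ 2)) * (exp (- zeta_gen (z ^ 2)) * (of_real pi * z))"
      by (simp add: exp_minus)
    also have "\<dots> = exp (zeta_gen (z ^ 2)) * ((exp p - exp (- p)) / 2)"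
      by (simp only: exp_zeta_gen[OF nz(2)[OF z]]) (simp add: p_def)
    finally have "2 * (of_real pi * z) * exp (- p)
        = 2 * (exp (zeta_gen (z ^ 2)) * ((exp p - exp (- p)) / 2)) * exp (- p)"
      by (simp only:)
    also have "\<dots> = exp (zeta_gen (z ^ 2)) * (exp p * exp (- p) - exp (- p) * exp (- p))"
      by (simp add: field_simps)
    also have "exp p * exp (- p) = 1" by (simp add: exp_minus)
    finally have "exp (zeta_gen (z ^ 2)) * (1 - exp (- 2 * of_real pi * z))
        = 2 * of_real pi * z * exp (- of_real pi * z)"
      unfolding p2 by (simp add: p_def mult.assoc)
    then have "exp (zeta_gen (z ^ 2)) = exp (- of_real pi * z) * (2 * of_real pi * z)
        / (1 - exp (- 2 * of_real pi * z))"
      using ne by (subst nonzero_eq_divide_eq) (simp_all add: mult_ac)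
    also have "\<dots> = exp (- of_real pi * z + Ln (2 * of_real pi * z) - Ln (1 - exp (- 2 * of_real pi * z)))"
      using ne nz(1)[OF z] by (simp only: exp_diff exp_add) simp
    finally show ?thesis by (simp only: D_def exp_diff) simp
  qed
  have hol: "D holomorphic_on slit_disc"
  proof -
    have "(\<lambda>z. zeta_gen (z ^ 2)) holomorphic_on slit_disc"
      using nz(2) by (intro holomorphic_on_compose_gen[OF _ holomorphic_zeta_gen, unfolded o_def])
        (auto intro!: holomorphic_on_power holomorphic_on_ident simp: norm_power power_less_one_iff)
    then show ?thesis unfolding D_def
      by (intro holomorphic_intros) (use nz in auto)
  qed
  \<comment> \<open>Differentiating \<open>exp (D z) = 1\<close> gives
    \<open>exp (D z) * D' = 0\<close>.\<close>
  have "(D has_field_derivative 0) (at z)" if z: "z \<in> slit_disc" for z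
  proof -
    obtain d where d: "(D has_field_derivative d) (at z)"
      using hol z by (auto simp: holomorphic_on_open open_slit_disc)
    have "((\<lambda>z. exp (D z)) has_field_derivative exp (D z) * d) (at z)"
      by (rule DERIV_chain2[OF DERIV_exp d])
    moreover have "((\<lambda>z. exp (D z)) has_field_derivative 0) (at z)"
      by (rule has_field_derivative_transform_within_open[OF DERIV_const[of 1] open_slit_disc z])
        (simp add: expD)
    ultimately show ?thesis using d DERIV_unique expD[OF z] by fastforce
  qed
  then have "D constant_on slit_disc"
    by (intro has_field_derivative_0_imp_constant_on connected_slit_disc open_slit_disc)
  then obtain c where c: "\<And>z. z \<in> slit_disc \<Longrightarrow> D z = c" by (auto simp: constant_on_def)
  \<comment> \<open>At \<open>z = 1/2\<close> all terms of \<open>D\<close> are real, so the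
    multiple of \<open>2 pi i\<close> is zero and no branch correction appears.\<close>
  have half: "of_real (1/2) \<in> slit_disc" by (auto simp: slit_disc_def complex_nonpos_Reals_iff)
  have "Im (D (of_real (1/2))) = 0"
  proof -
    have "Im (zeta_gen (of_real ((1/2)^2))) = 0"
      by (rule Im_zeta_gen_of_real) (simp only: norm_of_real, simp add: power2_eq_square)
    moreover have "Im (Ln (of_real pi)) = 0" by simp
    moreover have "1 - exp (- of_real pi) = complex_of_real (1 - exp (- pi))"
      by (simp only: of_real_diff of_real_1 exp_of_real[symmetric] of_real_minus)
    moreover have "Im (Ln (of_real (1 - exp (- pi)))) = 0"
      by (rule Im_Ln_of_real) simp
    ultimately show ?thesis unfolding D_def by simp
  qed
  moreover obtain k :: int where "D (of_real (1/2)) = of_int (2 * k) * of_real pi * \<i>"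
    using expD[OF half] unfolding exp_eq_1 by (auto simp: complex_eq_iff)
  ultimately have "c = 0" using c[OF half] by (auto simp: complex_eq_iff)
  then show ?thesis using c[OF assms] by (simp add: D_def)
qed

text \<open>On the negative axis, evenness in \<open>z\<close> reduces to the formula at
  \<open>r = - z\<close>. The two jumps \<open>i pi\<close> cancel, and
  \<open>ln (e^(2 pi r) - 1) = 2 pi r + ln (1 - e^(- 2 pi r))\<close> corrects the sign of the
  linear term.\<close>

lemma zeta_gen_eq_polylog_cont:
  assumes "0 < norm z" "norm z < 1"
  shows "zeta_gen (z ^ 2) = - of_real pi * z + Ln (2 * of_real pi * z)
           + polylog_cont 1 (exp (- 2 * of_real pi * z))"
proof (cases "z \<in> \<real>\<^sub>\<le>\<^sub>0")
  case False
  then show ?thesis using zeta_gen_slit_disc[of z] assms by (simp add: slit_disc_def)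
next
  case True
  define r where "r = - Re z"
  have z: "z = - of_real r" and r: "0 < r" "r < 1"
    using True assms by (auto simp: complex_nonpos_Reals_iff r_def complex_eq_iff cmod_def)
  have "of_real r \<in> slit_disc" using r by (auto simp: slit_disc_def)
  from zeta_gen_slit_disc[OF this]
  have 1: "zeta_gen (z ^ 2) = - of_real pi * of_real r + Ln (of_real (2 * pi * r))
      - Ln (of_real (1 - exp (- (2 * pi * r))))"
    by (simp add: z exp_of_real[symmetric])
  have "exp (2 * pi * r) - 1 = exp (2 * pi * r) * (1 - exp (- (2 * pi * r)))"
    by (simp add: algebra_simps flip: exp_add)
  then have 2: "ln (exp (2 * pi * r) - 1) = 2 * pi * r + ln (1 - exp (- (2 * pi * r)))"
    using r by (simp add: ln_mult)
  have 3: "Ln (2 * of_real pi * z) = of_real (ln (2 * pi * r)) + \<i> * of_real pi"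
    using Ln_of_real_cases[of "- (2 * pi * r)"] r by (simp add: z)
  have 4: "Ln (1 - exp (- 2 * of_real pi * z)) = of_real (ln (exp (2 * pi * r) - 1)) + \<i> * of_real pi"
    using Ln_of_real_cases[of "1 - exp (2 * pi * r)"] r by (simp add: z exp_of_real[symmetric])
  have 5: "Ln (of_real (2 * pi * r)) = of_real (ln (2 * pi * r))"
     "Ln (of_real (1 - exp (- (2 * pi * r)))) = of_real (ln (1 - exp (- (2 * pi * r))))"
    using r by (intro Ln_of_real; simp)+
  show ?thesis unfolding One_nat_def polylog_cont.simps 1 3 4 5 2 by (simp add: z)
qed

subsection \<open>The weighted series and its primitive\<close>

text \<open>Recasts one-variable derivatives as complex derivatives within the reals, so that one
  derivative computation for \<open>zeta_primitive\<close> serves the slit disc and the negative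
  axis alike.\<close>

lemma has_field_derivative_within_Reals:
  fixes f :: "complex \<Rightarrow> complex"
  assumes "((\<lambda>t. f (of_real t)) has_vector_derivative D) (at t)"
  shows "(f has_field_derivative D) (at (of_real t) within \<real>)"
proof -
  have "((\<lambda>s. (f (of_real s) - f (of_real t)) / of_real (s - t)) \<longlongrightarrow> D) (at t)"
  proof (rule LIM_zero_cancel, rule tendsto_norm_zero_cancel)
    have "((\<lambda>s. norm (f (of_real s) - f (of_real t) - (s - t) *\<^sub>R D) / norm (s - t)) \<longlongrightarrow> 0) (at t)"
      using assms unfolding has_vector_derivative_def has_derivative_iff_norm by simp
    then show "((\<lambda>s. norm ((f (of_real s) - f (of_real t)) / of_real (s - t) - D)) \<longlongrightarrow> 0) (at t)"
    proof (rule Lim_transform_eventually)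
      have "norm (f (of_real s) - f (of_real t) - (s - t) *\<^sub>R D) / norm (s - t)
          = norm ((f (of_real s) - f (of_real t)) / of_real (s - t) - D)" if "s \<noteq> t" for s
      proof -
        have "(f (of_real s) - f (of_real t)) / of_real (s - t) - D
            = (f (of_real s) - f (of_real t) - (s - t) *\<^sub>R D) / of_real (s - t)"
          using that by (simp add: scaleR_conv_of_real diff_divide_distrib del: of_real_diff)
        then show ?thesis by (simp only: norm_divide norm_of_real real_norm_def)
      qed
      then show "\<forall>\<^sub>F s in at t. norm (f (of_real s) - f (of_real t) - (s - t) *\<^sub>R D) / norm (s - t)
          = norm ((f (of_real s) - f (of_real t)) / of_real (s - t) - D)"
        by (simp add: eventually_at_filter)
    qed
  qed
  moreover have "filterlim Re (at t) (at (of_real t) within \<real>)"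
    unfolding filterlim_at
    by (auto simp: eventually_at_filter complex_eq_iff elim!: Reals_cases intro!: always_eventually tendsto_eq_intros)
  ultimately have "((\<lambda>y. (f (of_real (Re y)) - f (of_real t)) / of_real (Re y - t)) \<longlongrightarrow> D) (at (of_real t) within \<real>)"
    by (rule filterlim_compose)
  then have "((\<lambda>y. (f y - f (of_real t)) / (y - of_real t)) \<longlongrightarrow> D) (at (of_real t) within \<real>)"
    by (rule Lim_transform_eventually) (auto simp: eventually_at_filter elim!: Reals_cases intro!: always_eventually)
  then show ?thesis by (simp add: has_field_derivative_iff)
qed

text \<open>\<open>z^n\<close> times the right-hand side of the theorem, with \<open>P s\<close> in place of \<open>Li_s(e^(-2\<pi>z))\<close>.\<close>

definition zeta_primitive :: "nat \<Rightarrow> (nat \<Rightarrow> complex) \<Rightarrow> complex \<Rightarrow> complex" where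
  "zeta_primitive n P z =
     - (z ^ n) / of_nat n ^ 2 - of_real pi * z ^ Suc n / of_nat (Suc n)
     + z ^ n * Ln (2 * of_real pi * z) / of_nat n
     + fact (n - 1) * of_real (riemann_zeta (n + 1)) / (2 * of_real pi) ^ n
     - fact (n - 1) * (\<Sum>j = 1..n. P (j + 1) * z ^ (n - j) / (fact (n - j) * (2 * of_real pi) ^ j))"

text \<open>By the product rule the \<open>j\<close>-th term has derivative
  \<open>u' j - u j\<close>, where \<open>u' j\<close> is \<open>u (j + 1)\<close> for
  \<open>j < n\<close>. The sum collapses to \<open>- u 1\<close>.\<close>

lemma has_field_derivative_telescoping_sum:
  fixes P :: "nat \<Rightarrow> complex \<Rightarrow> complex"
  assumes "n \<ge> 1" "c \<noteq> 0"
    and P: "\<And>s. s \<ge> 1 \<Longrightarrow> (P (Suc s) has_field_derivative - c * P s z) (at z within S)"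
  shows "((\<lambda>z. \<Sum>j = 1..n. P (j + 1) z * z ^ (n - j) / (fact (n - j) * c ^ j)) has_field_derivative
           - P 1 z * z ^ (n - 1) / fact (n - 1)) (at z within S)"
proof -
  define u where "u = (\<lambda>j. P j z * z ^ (n - j) / (fact (n - j) * c ^ (j - 1)))"
  \<comment> \<open>The term with \<open>j = n\<close> carries \<open>z^0\<close>, so
    differentiating the power contributes nothing and the telescope ends.\<close>
  define u' where "u' = (\<lambda>j. if j = n then 0 else P (Suc j) z * z ^ (n - Suc j) / (fact (n - Suc j) * c ^ j))"
  have "((\<lambda>z. P (j + 1) z * z ^ (n - j) / (fact (n - j) * c ^ j)) has_field_derivative u' j - u j) (at z within S)"
    if j: "j \<in> {1..n}" for j
  proof -
    have "((\<lambda>z. z ^ (n - j)) has_field_derivative of_nat (n - j) * z ^ (n - j - 1)) (at z within S)"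
      by (auto intro!: derivative_eq_intros)
    from DERIV_mult[OF P[of j] this] j
    have "((\<lambda>z. P (j + 1) z * z ^ (n - j)) has_field_derivative
        - c * P j z * z ^ (n - j) + of_nat (n - j) * z ^ (n - j - 1) * P (Suc j) z) (at z within S)"
      by simp
    then have "((\<lambda>z. P (j + 1) z * z ^ (n - j) / (fact (n - j) * c ^ j)) has_field_derivative
        (- c * P j z * z ^ (n - j) + of_nat (n - j) * z ^ (n - j - 1) * P (Suc j) z) / (fact (n - j) * c ^ j)) (at z within S)"
      by (rule DERIV_cdivide)
    moreover have "c ^ j = c * c ^ (j - 1)" using j by (cases j) auto
    then have "- c * P j z * z ^ (n - j) / (fact (n - j) * c ^ j) = - u j"
      using assms(2) by (simp add: u_def)
    moreover have "of_nat (n - j) * z ^ (n - j - 1) * P (Suc j) z / (fact (n - j) * c ^ j) = u' j"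
    proof (cases "j = n")
      case False
      then obtain m where "n - j = Suc m" using j by (cases "n - j") auto
      moreover from this have "n - Suc j = m" by simp
      ultimately show ?thesis using False
        by (simp add: u'_def field_simps del: of_nat_Suc)
    qed (simp add: u'_def)
    ultimately show ?thesis by (simp add: diff_divide_distrib)
  qed
  then have "((\<lambda>z. \<Sum>j = 1..n. P (j + 1) z * z ^ (n - j) / (fact (n - j) * c ^ j)) has_field_derivative
      (\<Sum>j = 1..n. u' j - u j)) (at z within S)"
    by (intro DERIV_sum)
  moreover have "(\<Sum>j = 1..n. u' j - u j) = - u 1"
  proof -
    obtain m where n: "n = Suc m" using assms by (cases n) auto
    have "(\<Sum>j = 1..n. u' j) = (\<Sum>j = 1..m. u (Suc j))"
      unfolding n by (auto simp: u'_def u_def n intro!: sum.cong)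
    also have "\<dots> = (\<Sum>j = 2..n. u j)"
      unfolding n using sum.shift_bounds_cl_Suc_ivl[of u 1 m] by (simp add: numeral_2_eq_2)
    also have "\<dots> = (\<Sum>j = 1..n. u j) - u 1"
      using assms(1) by (subst sum.atLeast_Suc_atMost[of 1 n]) (auto simp: numeral_2_eq_2)
    finally show ?thesis by (simp add: sum_subtractf)
  qed
  ultimately show ?thesis by (simp add: u_def)
qed

text \<open>The term \<open>- z^n / n^2\<close> cancels the \<open>z^(n-1) / n\<close> left over
  when \<open>z^n Ln (2 pi z) / n\<close> is differentiated; the polylogarithm sum telescopes to
  order one.\<close>

lemma has_field_derivative_zeta_primitive:
  fixes P :: "nat \<Rightarrow> complex \<Rightarrow> complex"
  assumes "n \<ge> 1" "z \<noteq> 0"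
    and Ln: "((\<lambda>z. Ln (2 * of_real pi * z)) has_field_derivative 1 / z) (at z within S)"
    and P: "\<And>s. s \<ge> 1 \<Longrightarrow> (P (Suc s) has_field_derivative - (2 * of_real pi) * P s z) (at z within S)"
  shows "((\<lambda>z. zeta_primitive n (\<lambda>s. P s z) z) has_field_derivative
           z ^ (n - 1) * (- of_real pi * z + Ln (2 * of_real pi * z) + P 1 z)) (at z within S)"
proof -
  obtain m where n: "n = Suc m" using assms by (cases n) auto
  have nz: "of_nat n \<noteq> (0::complex)" "of_nat (Suc n) \<noteq> (0::complex)"
    using assms by (auto simp del: of_nat_Suc)
  have 1: "((\<lambda>z. - (z ^ n) / of_nat n ^ 2) has_field_derivative - (z ^ (n - 1)) / of_nat n) (at z within S)"
    using nz by (auto intro!: derivative_eq_intros simp: power2_eq_square)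
  have 2: "((\<lambda>z. of_real pi * z ^ Suc n / of_nat (Suc n)) has_field_derivative of_real pi * z ^ n) (at z within S)"
    using nz by (auto intro!: derivative_eq_intros simp del: power_Suc of_nat_Suc)
  have 3: "((\<lambda>z. z ^ n * Ln (2 * of_real pi * z) / of_nat n) has_field_derivative
      z ^ (n - 1) * Ln (2 * of_real pi * z) + z ^ (n - 1) / of_nat n) (at z within S)"
  proof -
    have "((\<lambda>z. z ^ n * Ln (2 * of_real pi * z)) has_field_derivative
        of_nat n * z ^ (n - 1) * Ln (2 * of_real pi * z) + 1 / z * z ^ n) (at z within S)"
      by (rule DERIV_mult[OF _ Ln]) (auto intro!: derivative_eq_intros)
    from DERIV_cdivide[OF this, of "of_nat n"] show ?thesis
      using nz \<open>z \<noteq> 0\<close> by (simp add: add_divide_distrib n del: of_nat_Suc)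
  qed
  have 4: "((\<lambda>z. \<Sum>j = 1..n. P (j + 1) z * z ^ (n - j) / (fact (n - j) * (2 * of_real pi) ^ j)) has_field_derivative
           - P 1 z * z ^ (n - 1) / fact (n - 1)) (at z within S)"
    by (rule has_field_derivative_telescoping_sum) (use assms(1) P in auto)
  have "((\<lambda>z. zeta_primitive n (\<lambda>s. P s z) z) has_field_derivative
      - (z ^ (n - 1)) / of_nat n - of_real pi * z ^ n + (z ^ (n - 1) * Ln (2 * of_real pi * z) + z ^ (n - 1) / of_nat n)
      + 0 - fact (n - 1) * (- P 1 z * z ^ (n - 1) / fact (n - 1))) (at z within S)"
    unfolding zeta_primitive_def by (intro DERIV_diff DERIV_add 1 2 3 DERIV_cmult 4 DERIV_const)
  then show ?thesis by (simp add: n algebra_simps)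
qed

section \<open>Limits at the origin along the reals\<close>

lemma times_Ln_of_real:
  "of_real u * Ln (of_real u) = of_real (u * ln \<bar>u\<bar>) + \<i> * of_real (pi * min 0 u)"
  using Ln_of_real_cases[of u] by (cases "u = 0") (auto simp: algebra_simps)

text \<open>In the sum only \<open>j = n\<close> survives, with limit
  \<open>Li_(n+1)(1) = zeta(n+1)\<close>, which the zeta term cancels. The limit is two-sided
  because \<open>Li_(j+1)\<close> is continuous along the reals through \<open>1\<close>.\<close>

lemma zeta_primitive_tendsto_0:
  assumes "n \<ge> 1"
  shows "((\<lambda>t. zeta_primitive n (\<lambda>s. polylog_cont s (exp (- 2 * of_real pi * of_real t))) (of_real t)) \<longlongrightarrow> 0) (at 0)"
proof -
  obtain m where n: "n = Suc m" using assms by (cases n) auto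
  have "continuous_on UNIV (\<lambda>t. of_real (2 * pi * t) * Ln (of_real (2 * pi * t)) :: complex)"
  proof -
    have "continuous_on UNIV (\<lambda>t. (2 * pi * t) * ln \<bar>2 * pi * t\<bar>)"
      by (rule continuous_on_compose2[OF continuous_on_times_ln_abs, of _ "\<lambda>t. 2 * pi * t"])
        (auto intro!: continuous_intros)
    then show ?thesis unfolding times_Ln_of_real
      by (intro continuous_on_add[OF continuous_on_of_real continuous_on_mult] continuous_on_of_real
          continuous_on_mult[OF continuous_on_const] continuous_on_const
          continuous_on_min continuous_on_id)
  qed
  then have "isCont (\<lambda>t. of_real (2 * pi * t) * Ln (of_real (2 * pi * t)) :: complex) 0"
    by (simp add: continuous_on_eq_continuous_at)
  then have "((\<lambda>t. of_real (2 * pi * t) * Ln (of_real (2 * pi * t)) :: complex) \<longlongrightarrow> 0) (at 0)"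
    by (simp add: isCont_def)
  \<comment> \<open>One factor of \<open>t^n\<close> with \<open>n = m + 1\<close> tames the
    logarithm; the remaining \<open>t^m\<close> stays bounded.\<close>
  then have "((\<lambda>t. of_real t ^ m / (2 * of_real pi) * (of_real (2 * pi * t) * Ln (of_real (2 * pi * t))) :: complex)
      \<longlongrightarrow> of_real 0 ^ m / (2 * of_real pi) * 0) (at 0)"
    by (intro tendsto_intros) auto
  then have Ln: "((\<lambda>t. of_real t ^ n * Ln (2 * of_real pi * of_real t) :: complex) \<longlongrightarrow> 0) (at 0)"
    by (simp add: n mult_ac)
  have P: "((\<lambda>t. polylog_cont (j + 1) (exp (- 2 * of_real pi * of_real t))) \<longlongrightarrow> of_real (riemann_zeta (j + 1))) (at 0)"
    if "j \<ge> 1" for j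
  proof -
    have "((\<lambda>t. exp (- 2 * pi * t)) \<longlongrightarrow> 1) (at 0)" by (auto intro!: tendsto_eq_intros)
    moreover have "isCont (\<lambda>t. polylog_cont (j + 1) (of_real t)) 1"
      by (rule isCont_polylog_cont_of_real) (use that in auto)
    ultimately have "((\<lambda>t. polylog_cont (j + 1) (of_real (exp (- 2 * pi * t)))) \<longlongrightarrow> polylog_cont (j + 1) (of_real 1)) (at 0)"
      by (rule isCont_tendsto_compose[rotated])
    moreover have "polylog_cont (j + 1) (of_real 1) = polylog (j + 1) (of_real 1)"
      by (rule polylog_of_real_eq_polylog_cont[symmetric]) (use that in auto)
    moreover have "polylog (j + 1) 1 = of_real (riemann_zeta (j + 1))"
    proof -
      have "(\<lambda>k. of_real (1 / real (Suc k) ^ (j + 1)) :: complex) sums of_real (riemann_zeta (j + 1))"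
        unfolding riemann_zeta_def by (intro sums_of_real summable_sums summable_zeta) (use that in auto)
      then show ?thesis by (simp add: polylog_def sums_iff)
    qed
    ultimately show ?thesis by (simp add: exp_of_real[symmetric])
  qed
  have "((\<lambda>t. \<Sum>j = 1..n. polylog_cont (j + 1) (exp (- 2 * of_real pi * of_real t)) * of_real t ^ (n - j)
        / (fact (n - j) * (2 * of_real pi) ^ j)) \<longlongrightarrow>
      (\<Sum>j = 1..n. of_real (riemann_zeta (j + 1)) * of_real 0 ^ (n - j) / (fact (n - j) * (2 * of_real pi) ^ j))) (at 0)"
    by (intro tendsto_intros P) auto
  also have "(\<Sum>j = 1..n. of_real (riemann_zeta (j + 1)) * of_real 0 ^ (n - j) / (fact (n - j) * (2 * of_real pi) ^ j))
      = (\<Sum>j = 1..n. if j = n then of_real (riemann_zeta (n + 1)) / (2 * of_real pi) ^ n else 0 :: complex)"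
    by (intro sum.cong) (auto simp: power_0_left)
  also have "\<dots> = (of_real (riemann_zeta (n + 1)) / (2 * of_real pi) ^ n :: complex)"
    using assms by simp
  finally have "((\<lambda>t. zeta_primitive n (\<lambda>s. polylog_cont s (exp (- 2 * of_real pi * of_real t))) (of_real t)) \<longlongrightarrow>
      - (of_real 0 ^ n) / of_nat n ^ 2 - of_real pi * of_real 0 ^ Suc n / of_nat (Suc n) + 0 / of_nat n
      + fact (n - 1) * of_real (riemann_zeta (n + 1)) / (2 * of_real pi) ^ n
      - fact (n - 1) * (of_real (riemann_zeta (n + 1)) / (2 * of_real pi) ^ n)) (at 0)"
    unfolding zeta_primitive_def
    by (intro tendsto_intros Ln) (use assms in \<open>auto simp del: of_nat_Suc\<close>)
  then show ?thesis using assms by (simp add: n)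
qed

lemma weighted_sum_minus_primitive_tendsto_0:
  assumes "n \<ge> 1"
  shows "((\<lambda>t. of_real t ^ n * zeta_gen_weighted n (of_real t ^ 2)
           - zeta_primitive n (\<lambda>s. polylog_cont s (exp (- 2 * of_real pi * of_real t))) (of_real t)) \<longlongrightarrow> 0) (at 0)"
proof -
  have "isCont (\<lambda>z. z ^ n * zeta_gen_weighted n (z ^ 2)) 0"
    by (rule DERIV_isCont[OF has_field_derivative_zeta_gen_weighted]) (use assms in auto)
  then have "((\<lambda>t. of_real t ^ n * zeta_gen_weighted n (of_real t ^ 2)) \<longlongrightarrow> 0 ^ n * zeta_gen_weighted n (0 ^ 2)) (at (0::real))"
    by (rule isCont_tendsto_compose) (auto intro!: tendsto_eq_intros)
  from tendsto_diff[OF this zeta_primitive_tendsto_0[OF assms]] show ?thesis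
    using assms by (simp add: power_0_left)
qed

section \<open>The identity inside the unit disc\<close>

text \<open>Both sides have derivative \<open>z^(n-1) G(z)\<close> on a connected open set, and
  their difference tends to \<open>0\<close> as \<open>z\<close> approaches \<open>0\<close> through
  positive reals.\<close>

lemma weighted_sum_eq_primitive_slit_disc:
  assumes "n \<ge> 1" "z \<in> slit_disc"
  shows "z ^ n * zeta_gen_weighted n (z ^ 2)
           = zeta_primitive n (\<lambda>s. polylog_cont s (exp (- 2 * of_real pi * z))) z"
proof -
  define D where "D = (\<lambda>z. z ^ n * zeta_gen_weighted n (z ^ 2)
    - zeta_primitive n (\<lambda>s. polylog_cont s (exp (- 2 * of_real pi * z))) z)"
  have "(D has_field_derivative 0) (at z)" if z: "z \<in> slit_disc" for z
  proof -
    have z': "z \<noteq> 0" "norm z < 1" "z \<notin> \<real>\<^sub>\<le>\<^sub>0" using z by (auto simp: slit_disc_def)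
    have "((\<lambda>z. zeta_primitive n (\<lambda>s. polylog_cont s (exp (- 2 * of_real pi * z))) z) has_field_derivative
        z ^ (n - 1) * (- of_real pi * z + Ln (2 * of_real pi * z) + polylog_cont 1 (exp (- 2 * of_real pi * z)))) (at z)"
    proof (rule has_field_derivative_zeta_primitive[where P = "\<lambda>s z. polylog_cont s (exp (- 2 * of_real pi * z))", OF assms(1) z'(1)])
      show "((\<lambda>z. Ln (2 * of_real pi * z)) has_field_derivative 1 / z) (at z)"
      proof -
        have "((\<lambda>z. Ln (2 * of_real pi * z)) has_field_derivative
            inverse (2 * of_real pi * z) * (2 * of_real pi)) (at z)"
          by (rule DERIV_chain2[OF has_field_derivative_Ln])
            (use z' in \<open>auto simp: two_pi_mult_nonpos_Reals_iff intro!: derivative_eq_intros\<close>)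
        then show ?thesis using z' by (simp add: field_simps)
      qed
      fix s :: nat assume s: "s \<ge> 1"
      have "((\<lambda>z. exp (- 2 * of_real pi * z)) has_field_derivative
          exp (- 2 * of_real pi * z) * (- 2 * of_real pi)) (at z)"
        by (auto intro!: derivative_eq_intros)
      from DERIV_chain2[OF has_field_derivative_polylog_cont[OF s exp_in_slit_plane_slit_disc[OF z]] this]
      show "((\<lambda>z. polylog_cont (Suc s) (exp (- 2 * of_real pi * z))) has_field_derivative
          - (2 * of_real pi) * polylog_cont s (exp (- 2 * of_real pi * z))) (at z)"
        by (simp add: mult_ac)
    qed
    from DERIV_diff[OF has_field_derivative_zeta_gen_weighted[OF assms(1) z'(2)] this]
    show ?thesis using zeta_gen_eq_polylog_cont[of z] z' unfolding D_def by simp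
  qed
  then have "D constant_on slit_disc"
    by (intro has_field_derivative_0_imp_constant_on connected_slit_disc open_slit_disc)
  then obtain c where c: "\<And>z. z \<in> slit_disc \<Longrightarrow> D z = c" by (auto simp: constant_on_def)
  have "c = 0"
  proof (rule tendsto_unique)
    have "\<forall>\<^sub>F t in at_right (0::real). of_real t \<in> slit_disc"
      by (rule eventually_at_rightI[of 0 1]) (auto simp: slit_disc_def)
    then show "((\<lambda>t. D (of_real t)) \<longlongrightarrow> c) (at_right (0::real))"
      by (rule tendsto_eventually[OF eventually_mono]) (rule c)
    show "((\<lambda>t. D (of_real t)) \<longlongrightarrow> 0) (at_right (0::real))"
      using weighted_sum_minus_primitive_tendsto_0[OF assms(1)] unfolding D_def
      by (rule tendsto_within_subset) auto
  qed auto
  then show ?thesis using c[OF assms(2)] by (simp add: D_def)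
qed

text \<open>Here \<open>e^(- 2 pi z)\<close> lies on the cut, so all derivatives are taken within
  the real segment \<open>T\<close>, and the constant is found by approaching \<open>0\<close> from
  the left.\<close>

lemma weighted_sum_eq_primitive_neg_real:
  assumes "n \<ge> 1" "-1 < t" "t < 0"
  shows "of_real t ^ n * zeta_gen_weighted n (of_real t ^ 2)
           = zeta_primitive n (\<lambda>s. polylog_cont s (exp (- 2 * of_real pi * of_real t))) (of_real t)"
proof -
  define T where "T = complex_of_real ` {-1<..<0}"
  define D where "D = (\<lambda>z. z ^ n * zeta_gen_weighted n (z ^ 2)
    - zeta_primitive n (\<lambda>s. polylog_cont s (exp (- 2 * of_real pi * z))) z)"
  have "convex T" unfolding T_def
    by (intro convex_linear_image linear_of_real) auto
  moreover have "(D has_field_derivative 0) (at z within T)" if z: "z \<in> T" for z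
  proof -
    obtain t where t: "z = of_real t" "-1 < t" "t < 0" using z by (auto simp: T_def)
    have z': "z \<noteq> 0" "norm z < 1" using t by auto
    have TR: "T \<subseteq> \<real>" by (auto simp: T_def)
    have "((\<lambda>z. zeta_primitive n (\<lambda>s. polylog_cont s (exp (- 2 * of_real pi * z))) z) has_field_derivative
        z ^ (n - 1) * (- of_real pi * z + Ln (2 * of_real pi * z) + polylog_cont 1 (exp (- 2 * of_real pi * z)))) (at z within T)"
    proof (rule has_field_derivative_zeta_primitive[where P = "\<lambda>s z. polylog_cont s (exp (- 2 * of_real pi * z))", OF assms(1) z'(1)])
      \<comment> \<open>On the negative axis the argument of \<open>2 pi t\<close> stays equal to
        \<open>pi\<close>, so only the real logarithm varies.\<close>
      have "((\<lambda>t. of_real (ln (- (2 * pi * t))) + \<i> * of_real pi) has_vector_derivative of_real (1 / t)) (at t)"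
      proof -
        have "((\<lambda>t. ln (- (2 * pi * t))) has_real_derivative 1 / t) (at t)"
          using t by (auto intro!: derivative_eq_intros simp: mult_less_0_iff)
        from has_vector_derivative_add[OF has_vector_derivative_of_real[OF this] has_vector_derivative_const[of "\<i> * of_real pi"]]
        show ?thesis by simp
      qed
      then have "((\<lambda>t. Ln (2 * of_real pi * of_real t)) has_vector_derivative of_real (1 / t)) (at t)"
      proof (rule has_vector_derivative_transform_within_open)
        show "of_real (ln (- (2 * pi * t))) + \<i> * of_real pi = Ln (2 * of_real pi * of_real t)"
          if "t \<in> {..<0}" for t
          using Ln_of_real_cases[of "2 * pi * t"] that by (auto simp: mult_less_0_iff abs_mult)
      qed (use t in auto)
      from has_field_derivative_within_Reals[OF this]
      show "((\<lambda>z. Ln (2 * of_real pi * z)) has_field_derivative 1 / z) (at z within T)"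
        using TR t by (auto intro: DERIV_subset)
      fix s :: nat assume s: "s \<ge> 1"
      have "((\<lambda>t. exp (- 2 * pi * t)) has_vector_derivative exp (- 2 * pi * t) * (- 2 * pi)) (at t)"
        unfolding has_real_derivative_iff_has_vector_derivative[symmetric]
        by (auto intro!: derivative_eq_intros)
      from vector_diff_chain_at[OF this has_vector_derivative_polylog_cont_of_real[OF s]]
      have "((\<lambda>t. polylog_cont (Suc s) (exp (- 2 * of_real pi * of_real t))) has_vector_derivative
          - (2 * of_real pi) * polylog_cont s (exp (- 2 * of_real pi * of_real t))) (at t)"
        using t by (simp add: o_def exp_of_real[symmetric] scaleR_conv_of_real mult_less_0_iff mult.assoc)
      from has_field_derivative_within_Reals[where f = "\<lambda>z. polylog_cont (Suc s) (exp (- 2 * of_real pi * z))", OF this]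
      show "((\<lambda>z. polylog_cont (Suc s) (exp (- 2 * of_real pi * z))) has_field_derivative
          - (2 * of_real pi) * polylog_cont s (exp (- 2 * of_real pi * z))) (at z within T)"
        using TR t by (auto intro: DERIV_subset)
    qed
    from DERIV_diff[OF has_field_derivative_at_within[OF has_field_derivative_zeta_gen_weighted[OF assms(1) z'(2)]] this]
    show ?thesis using zeta_gen_eq_polylog_cont[of z] z' unfolding D_def by simp
  qed
  ultimately obtain c where c: "\<And>z. z \<in> T \<Longrightarrow> D z = c"
    using has_field_derivative_zero_constant[of T D] by blast
  have "c = 0"
  proof (rule tendsto_unique)
    have "\<forall>\<^sub>F t in at_left (0::real). of_real t \<in> T"
      by (rule eventually_at_leftI[of "-1"]) (auto simp: T_def)
    then show "((\<lambda>t. D (of_real t)) \<longlongrightarrow> c) (at_left (0::real))"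
      by (rule tendsto_eventually[OF eventually_mono]) (rule c)
    show "((\<lambda>t. D (of_real t)) \<longlongrightarrow> 0) (at_left (0::real))"
      using weighted_sum_minus_primitive_tendsto_0[OF assms(1)] unfolding D_def
      by (rule tendsto_within_subset) auto
  qed auto
  moreover have "of_real t \<in> T" using assms by (auto simp: T_def)
  ultimately show ?thesis using c[of "of_real t"] by (simp add: D_def)
qed

text \<open>\<open>zeta_primitive\<close> evaluates \<open>P\<close> at \<open>j + 1\<close> with
  \<open>j \<ge> 1\<close>, so agreement of \<open>polylog\<close> and \<open>polylog_cont\<close>
  from order two on lets one replace the other.\<close>

lemma zeta_primitive_cong:
  "(\<And>s. s \<ge> 2 \<Longrightarrow> P s = Q s) \<Longrightarrow> zeta_primitive n P z = zeta_primitive n Q z"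
  unfolding zeta_primitive_def by (intro arg_cong2[of _ _ _ _ "(-)"] arg_cong2[of _ _ _ _ "(*)"] refl sum.cong) auto

lemma weighted_sum_eq_primitive_open:
  assumes "n \<ge> 1" "0 < norm z" "norm z < 1"
  shows "z ^ n * zeta_gen_weighted n (z ^ 2)
           = zeta_primitive n (\<lambda>s. polylog s (exp (- 2 * of_real pi * z))) z"
proof (cases "z \<in> \<real>\<^sub>\<le>\<^sub>0")
  case False
  then have z: "z \<in> slit_disc" using assms by (auto simp: slit_disc_def)
  show ?thesis
    unfolding weighted_sum_eq_primitive_slit_disc[OF assms(1) z]
    by (intro zeta_primitive_cong polylog_eq_polylog_cont[symmetric] exp_in_slit_plane_slit_disc z)
next
  case True
  then obtain t where z: "z = of_real t" "t \<le> 0"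
    by (auto elim!: nonpos_Reals_cases)
  then have t: "-1 < t" "t < 0" using assms by auto
  have "polylog s (exp (- 2 * of_real pi * of_real t)) = polylog_cont s (exp (- 2 * of_real pi * of_real t))"
    if "s \<ge> 2" for s
    using polylog_of_real_eq_polylog_cont[OF that, of "exp (- 2 * pi * t)"] by (simp add: exp_of_real[symmetric])
  then show ?thesis
    unfolding z weighted_sum_eq_primitive_neg_real[OF assms(1) t]
    by (intro zeta_primitive_cong) simp
qed

section \<open>Passage to the unit circle\<close>

text \<open>If \<open>Re z \<ge> 0\<close>, the argument stays in the closed disc, where the series
  is continuous; this includes \<open>z = i\<close> and \<open>z = -i\<close>. If
  \<open>Re z < 0\<close> and \<open>z\<close> is not real, the limit point lies in the slit plane.
  At \<open>z = -1\<close> the path follows the cut, and continuity along the reals applies.\<close>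

lemma polylog_exp_radial_limit:
  assumes "s \<ge> 2" "norm z = 1"
  shows "((\<lambda>r. polylog s (exp (- 2 * of_real pi * (of_real r * z)))) \<longlongrightarrow> polylog s (exp (- 2 * of_real pi * z))) (at_left 1)"
proof -
  have ev: "\<forall>\<^sub>F r in at_left (1::real). r \<in> {0<..<1}"
    by (rule eventually_at_leftI[of 0]) auto
  have lim: "((\<lambda>r. exp (- 2 * of_real pi * (of_real r * z))) \<longlongrightarrow> exp (- 2 * of_real pi * z)) (at_left 1)"
    by (auto intro!: tendsto_eq_intros)
  have "z = - 1" if "Re z < 0" "Im z = 0"
    using assms(2) that by (simp add: complex_eq_iff cmod_def)
  then consider "Re z \<ge> 0" | "Re z < 0" "Im z \<noteq> 0" | "z = - 1"
    by (meson not_le)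
  then show ?thesis
  proof cases
    case 1
    have *: "exp (- 2 * of_real pi * (of_real r * z)) \<in> cball 0 1" if "r \<ge> 0" for r
      using that 1 by simp
    have eq: "polylog_series s (exp (- 2 * of_real pi * (of_real r * z)))
        = polylog s (exp (- 2 * of_real pi * (of_real r * z)))" if "r \<ge> 0" for r
      using polylog_eq_series[of s "exp (- 2 * of_real pi * (of_real r * z))"] *[OF that] assms by auto
    have "((\<lambda>r. polylog_series s (exp (- 2 * of_real pi * (of_real r * z))))
        \<longlongrightarrow> polylog_series s (exp (- 2 * of_real pi * z))) (at_left 1)"
      by (rule continuous_on_tendsto_compose[OF continuous_on_polylog_series lim])
        (use assms *[of 1] in \<open>auto intro!: eventually_mono[OF ev] mult_nonneg_nonneg 1\<close>)
    then have "((\<lambda>r. polylog_series s (exp (- 2 * of_real pi * (of_real r * z))))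
        \<longlongrightarrow> polylog s (exp (- 2 * of_real pi * z))) (at_left 1)"
      using eq[of 1] by simp
    then show ?thesis
      by (rule Lim_transform_eventually) (rule eventually_mono[OF ev], rule eq, simp)
  next
    case 2
    let ?x = "exp (- 2 * of_real pi * z)"
    have x: "?x \<in> slit_plane"
      by (intro exp_in_slit_plane abs_Im_less_one) (use 2 assms in \<open>auto simp: complex_nonpos_Reals_iff\<close>)
    then have "\<forall>\<^sub>F r in at_left 1. exp (- 2 * of_real pi * (of_real r * z)) \<in> slit_plane"
      by (rule topological_tendstoD[OF lim open_slit_plane])
    moreover have "((\<lambda>r. polylog_cont s (exp (- 2 * of_real pi * (of_real r * z)))) \<longlongrightarrow> polylog_cont s ?x) (at_left 1)"
      by (rule isCont_tendsto_compose[OF isCont_polylog_cont lim]) (use assms x in auto)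
    ultimately show ?thesis
      unfolding polylog_eq_polylog_cont[OF assms(1) x]
      by (auto intro: Lim_transform_eventually elim!: eventually_mono simp: polylog_eq_polylog_cont[OF assms(1)])
  next
    case 3
    have "((\<lambda>r. exp (2 * pi * r)) \<longlongrightarrow> exp (2 * pi)) (at_left 1)" by (auto intro!: tendsto_eq_intros)
    then have "((\<lambda>r. polylog_cont s (of_real (exp (2 * pi * r)))) \<longlongrightarrow> polylog_cont s (of_real (exp (2 * pi)))) (at_left 1)"
      by (rule isCont_tendsto_compose[rotated]) (rule isCont_polylog_cont_of_real, use assms in auto)
    then have "((\<lambda>r. polylog s (of_real (exp (2 * pi * r)))) \<longlongrightarrow> polylog s (of_real (exp (2 * pi)))) (at_left 1)"
      by (simp only: polylog_of_real_eq_polylog_cont[OF assms(1) exp_gt_zero])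
    then show ?thesis by (simp add: 3 exp_of_real[symmetric])
  qed
qed

lemma weighted_sum_eq_primitive:
  assumes "n \<ge> 1" "0 < norm z" "norm z \<le> 1"
  shows "z ^ n * zeta_gen_weighted n (z ^ 2)
           = zeta_primitive n (\<lambda>s. polylog s (exp (- 2 * of_real pi * z))) z"
proof (cases "norm z < 1")
  case False
  then have z: "norm z = 1" "z \<noteq> 0" using assms by auto
  have ev: "\<forall>\<^sub>F r in at_left (1::real). r \<in> {0<..<1}"
    by (rule eventually_at_leftI[of 0]) auto
  have lim: "((\<lambda>r. of_real r * z) \<longlongrightarrow> z) (at_left 1)" by (auto intro!: tendsto_eq_intros)
  show ?thesis
  proof (rule tendsto_unique)
    have "((\<lambda>r. zeta_gen_weighted n ((of_real r * z) ^ 2)) \<longlongrightarrow> zeta_gen_weighted n (z ^ 2)) (at_left 1)"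
      by (rule continuous_on_tendsto_compose[OF continuous_on_zeta_gen_weighted tendsto_power[OF lim]])
        (use z in \<open>auto intro!: eventually_mono[OF ev] power_le_one simp: norm_power norm_mult\<close>)
    then have "((\<lambda>r. (of_real r * z) ^ n * zeta_gen_weighted n ((of_real r * z) ^ 2)) \<longlongrightarrow> z ^ n * zeta_gen_weighted n (z ^ 2)) (at_left 1)"
      by (intro tendsto_mult tendsto_power lim)
    moreover have "\<forall>\<^sub>F r in at_left (1::real). (of_real r * z) ^ n * zeta_gen_weighted n ((of_real r * z) ^ 2)
        = zeta_primitive n (\<lambda>s. polylog s (exp (- 2 * of_real pi * (of_real r * z)))) (of_real r * z)"
      using ev by eventually_elim (use z assms(1) in \<open>intro weighted_sum_eq_primitive_open; simp add: norm_mult\<close>)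
    ultimately show "((\<lambda>r. zeta_primitive n (\<lambda>s. polylog s (exp (- 2 * of_real pi * (of_real r * z)))) (of_real r * z))
        \<longlongrightarrow> z ^ n * zeta_gen_weighted n (z ^ 2)) (at_left 1)"
      by (rule Lim_transform_eventually)
    \<comment> \<open>Scaling by \<open>r > 0\<close> only adds \<open>ln r\<close>, so the radial
      limit exists even at \<open>z = -1\<close>, where \<open>Ln\<close> is discontinuous.\<close>
    have Ln: "((\<lambda>r. Ln (2 * of_real pi * (of_real r * z))) \<longlongrightarrow> Ln (2 * of_real pi * z)) (at_left 1)"
    proof (rule Lim_transform_eventually)
      have "((\<lambda>r. complex_of_real (ln r) + Ln (2 * of_real pi * z)) \<longlongrightarrow> of_real (ln 1) + Ln (2 * of_real pi * z)) (at_left 1)"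
        by (intro tendsto_intros) auto
      then show "((\<lambda>r. complex_of_real (ln r) + Ln (2 * of_real pi * z)) \<longlongrightarrow> Ln (2 * of_real pi * z)) (at_left 1)"
        by simp
      show "\<forall>\<^sub>F r in at_left 1. complex_of_real (ln r) + Ln (2 * of_real pi * z) = Ln (2 * of_real pi * (of_real r * z))"
        using ev
      proof eventually_elim
        case (elim r)
        then show ?case using Ln_times_of_real[of r "2 * of_real pi * z"] z by (simp add: mult_ac Ln_of_real)
      qed
    qed
    show "((\<lambda>r. zeta_primitive n (\<lambda>s. polylog s (exp (- 2 * of_real pi * (of_real r * z)))) (of_real r * z))
        \<longlongrightarrow> zeta_primitive n (\<lambda>s. polylog s (exp (- 2 * of_real pi * z))) z) (at_left 1)"
      unfolding zeta_primitive_def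
      by (intro tendsto_diff tendsto_add tendsto_divide tendsto_minus tendsto_mult tendsto_sum tendsto_const
          tendsto_power lim Ln polylog_exp_radial_limit z) (use assms(1) in \<open>auto simp del: of_nat_Suc\<close>)
  qed auto
qed (use weighted_sum_eq_primitive_open assms in auto)

theorem theorem1:
  fixes n :: nat and z :: complex
  assumes "n \<ge> 1" and "0 < norm z" and "norm z \<le> 1"
  shows "(\<lambda>m. let k = Suc m in
            (-1) ^ k * of_real (riemann_zeta (2 * k)) * z ^ (2 * k)
              / (of_nat k * of_nat (2 * k + n)))
         sums
         (- 1 / of_nat n ^ 2 - of_real pi * z / of_nat (n + 1)
          + Ln (2 * of_real pi * z) / of_nat n
          + of_nat (fact (n - 1)) / (2 * of_real pi * z) ^ n * of_real (riemann_zeta (n + 1))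
          - of_nat (fact (n - 1)) *
              (\<Sum>j = 1..n. polylog (j + 1) (exp (- 2 * of_real pi * z))
                           / (of_nat (fact (n - j)) * (2 * of_real pi * z) ^ j)))"
    (is "?f sums ?R")
proof -
  have z: "z \<noteq> 0" "norm (z ^ 2) \<le> 1" using assms by (auto simp: norm_power power_le_one)
  \<comment> \<open>The shift from \<open>k\<close> to \<open>Suc m\<close> drops only the term
    \<open>k = 0\<close>, whose coefficient is zero.\<close>
  have "(\<lambda>m. zeta_coeff (Suc m) / of_nat (2 * Suc m + n) * (z ^ 2) ^ Suc m) sums zeta_gen_weighted n (z ^ 2)"
    unfolding zeta_gen_weighted_def
    using summable_sums[OF summable_zeta_gen_weighted[OF z(2), of n]]
    by (subst sums_Suc_iff) (simp add: zeta_coeff_def)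
  moreover have "zeta_coeff (Suc m) / of_nat (2 * Suc m + n) * (z ^ 2) ^ Suc m = ?f m" for m
    by (simp only: Let_def zeta_coeff_def power_mult times_divide_eq_left divide_divide_eq_left)
  moreover have "zeta_gen_weighted n (z ^ 2) = ?R"
  proof -
    \<comment> \<open>Pulling out \<open>z^n\<close> turns \<open>z^(n-j)\<close> into
      \<open>1 / z^j\<close>, which completes the power \<open>(2 pi z)^j\<close> in the
      denominator.\<close>
    have "(\<Sum>j = 1..n. polylog (j + 1) (exp (- 2 * of_real pi * z)) * z ^ (n - j) / (fact (n - j) * (2 * of_real pi) ^ j))
        = z ^ n * (\<Sum>j = 1..n. polylog (j + 1) (exp (- 2 * of_real pi * z)) / (of_nat (fact (n - j)) * (2 * of_real pi * z) ^ j))"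
      unfolding sum_distrib_left
    proof (intro sum.cong refl)
      fix j assume "j \<in> {1..n}"
      then have "z ^ n = z ^ (n - j) * z ^ j" by (simp flip: power_add)
      then show "polylog (j + 1) (exp (- 2 * of_real pi * z)) * z ^ (n - j) / (fact (n - j) * (2 * of_real pi) ^ j)
          = z ^ n * (polylog (j + 1) (exp (- 2 * of_real pi * z)) / (of_nat (fact (n - j)) * (2 * of_real pi * z) ^ j))"
        using z(1) by (simp add: power_mult_distrib)
    qed
    then have "zeta_primitive n (\<lambda>s. polylog s (exp (- 2 * of_real pi * z))) z = z ^ n * ?R"
      using z(1) unfolding zeta_primitive_def
      by (simp add: ring_distribs power_mult_distrib)
    then show ?thesis
      using weighted_sum_eq_primitive[OF assms] z(1) by simp
  qed
  ultimately show ?thesis by (simp only:)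
qed

end
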